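(* Let $(\mathbf{C},\mathcal{M})$ satisfy the standing DPO assumptions of the context, let $X_0$ be an object and $R_j=(r_j,\mathsf{c}_{I_j})$, $j=1,2$, linear rules with application conditions. Then: (i) (Synthesis) For every sequence of DPO rule applications $X_1=r_{1,m_1}(X_0)$, $X_2=r_{2,m_2}(X_1)$ along admissible matches $m_1\in M_{R_1}(X_0)$ and $m_2\in M_{R_2}(X_1)$, there exist an admissible match $\mu_{21}\in M_{R_2}(R_1)$ and an admissible match $m_{21}\in M_{R_{21}}(X_0)$ of $R_{21}:=R_2\,{}^{\mu_{21}}\!\!\circ R_1=(r_{21},\mathsf{c}_{I_{21}})$, where $\mathsf{c}_{I_{21}}=\mathsf{Shift}(I_1\to I_{21},\mathsf{c}_{I_1})\wedge\mathsf{Trans}\big((N_{21}\leftarrow K_1'\to I_{21}),\mathsf{Shift}(I_2\to N_{21},\mathsf{c}_{I_2})\big)$ (objects and morphisms determined uniquely up to isomorphism by the data), such that $X_2\cong r_{21,m_{21}}(X_0)$. (ii) (Analysis) For every $\mu_{21}\in M_{R_2}(R_1)$ and every rule application $X_2=r_{21,m_{21}}(X_0)$ with $m_{21}\in M_{R_{21}}(X_0)$, $R_{21}=R_2\,{}^{\mu_{21}}\!\!\circ R_1$, there exists a pair of admissible matches $m_1\in M_{R_1}(X_0)$, $m_2\in M_{R_2}(X_1)$ with $X_1=r_{1,m_1}(X_0)$ such that $r_{2,m_2}(X_1)\cong X_2$. These two constructions establish a bijection between such two-step sequences and pairs $(\mu_{21},m_{21})$.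
   Context: Standing assumptions (DPO setting): $(\mathbf{C},\mathcal{M})$ is $\mathcal{M}$-adhesive with $\mathcal{M}$ a class of monomorphisms ($\mathcal{M}$ contains isos, closed under composition and decomposition, pushouts/pullbacks along $\mathcal{M}$-morphisms exist, $\mathcal{M}$ stable under them, pushouts along $\mathcal{M}$-morphisms are $\mathcal{M}$-van Kampen), with epi-$\mathcal{M}$-factorizations, balanced, with a strict $\mathcal{M}$-initial object $\varnothing$, and with $\mathcal{M}$-effective unions (if $\mathcal{M}$-morphisms $B\leftarrow A\to C$ have pushout $D$ and $\mathcal{M}$-morphisms $B\to E\leftarrow C$ form with them a pullback square, then the induced $D\to E$ is in $\mathcal{M}$). Conditions over $P$: $\mathsf{true}$, $\exists(a,\mathsf{c}_Q)$ with $a:P\to Q$ in $\mathcal{M}$, $\neg\mathsf{c}$, $\bigwedge_i\mathsf{c}_i$; $\mathsf{false}=\neg\mathsf{true}$, $\bigvee=\neg\bigwedge\neg$. An $\mathcal{M}$-morphism $p:P\to H$ satisfies $\exists(a,\mathsf{c}_Q)$ iff some $\mathcal{M}$-morphism $q:Q\to H$ has $q a=p$ and $q\models\mathsf{c}_Q$. $\equiv$: satisfied by the same $\mathcal{M}$-morphisms. $\mathsf{Shift}(p,\cdot)$ along $\mathcal{M}$-morphism $p:P\to Q$: commutes with $\mathsf{true},\neg,\bigwedge$; $\mathsf{Shift}(p,\exists(a:P\to A,\mathsf{c}_A))=\bigvee_{(r,s)}\exists(r,\mathsf{Shift}(s,\mathsf{c}_A))$ over iso classes of pushouts $(r:Q\to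 E,s:A\to E)$ of spans $Q\xleftarrow{p''}X\xrightarrow{a''}A$ of $\mathcal{M}$-morphisms admitting an $\mathcal{M}$-morphism $x:P\to X$ with $p''x=p$, $a''x=a$. Linear rule: span $r=(O\xleftarrow{o}K\xrightarrow{i}I)$ of $\mathcal{M}$-morphisms; rule with condition $R=(r,\mathsf{c}_I)$. $\mathsf{Trans}(r,\mathsf{c}_O)$ (over $I$): commutes with $\mathsf{true},\neg,\bigwedge$; for $\exists(a:O\to O',\mathsf{c}')$: if the pushout complement $K\to K'\xrightarrow{o'}O'$ of $K\xrightarrow{o}O\xrightarrow{a}O'$ exists, with $I\xrightarrow{a^*}I'\xleftarrow{i'}K'$ the pushout of $I\xleftarrow{i}K\to K'$ and $r'=(O'\xleftarrow{o'}K'\xrightarrow{i'}I')$, it is $\exists(a^*,\mathsf{Trans}(r',\mathsf{c}'))$, otherwise $\mathsf{false}$. DPO rewriting: $M_r(X)$ = $\mathcal{M}$-morphisms $m:I\to X$ for which $K\xrightarrow{i}I\xrightarrow{m}X$ has a pushout complement $K\to K'\to X$; $r_m(X)$ = pushout of $O\xleftarrow{o}K\to K'$. $M_R(X)=\{m\in M_r(X)\mid m\models\mathsf{c}_I\}$. Composition: for $R_j=(r_j,\mathsf{c}_{I_j})$, $r_j=(O_j\xleftarrow{o_j}K_j\xrightarrow{i_j}I_j)$, and a span of $\mathcal{M}$-morphisms $\mu_{21}=(I_2\leftarrow M_{21}\to O_1)$, let $I_2\xrightarrow{m_2'}N_{21}\xleftarrow{m_1'}O_1$ be its pushout; require pushout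 complements $K_2\to K_2'\to N_{21}$ of $K_2\xrightarrow{i_2}I_2\to N_{21}$ and $K_1\to K_1'\to N_{21}$ of $K_1\xrightarrow{o_1}O_1\to N_{21}$; $O_{21}$ = pushout of $O_2\leftarrow K_2\to K_2'$, $I_{21}$ = pushout of $K_1'\leftarrow K_1\to I_1$ (with $p_1:I_1\to I_{21}$), $K_{21}$ = pullback of $K_2'\to N_{21}\leftarrow K_1'$, $r_{21}=(O_{21}\leftarrow K_{21}\to I_{21})$, $\mathsf{c}_{I_{21}}=\mathsf{Shift}(p_1,\mathsf{c}_{I_1})\wedge\mathsf{Trans}((N_{21}\leftarrow K_1'\to I_{21}),\mathsf{Shift}(m_2',\mathsf{c}_{I_2}))$. If constructible and $\mathsf{c}_{I_{21}}\not\equiv\mathsf{false}$, $\mu_{21}\in M_{R_2}(R_1)$ and $R_2\,{}^{\mu_{21}}\!\!\circ R_1=(r_{21},\mathsf{c}_{I_{21}})$. *)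

theory Defs
  imports Main
begin

section \<open>Categories\<close>

record ('o, 'a) cat =
  Obj :: "'o set"
  Arr :: "'a set"
  Dom :: "'a \<Rightarrow> 'o"
  Cod :: "'a \<Rightarrow> 'o"
  Id :: "'o \<Rightarrow> 'a"
  Comp :: "'a \<Rightarrow> 'a \<Rightarrow> 'a" (infixl "\<cdot>\<index>" 70)

text \<open>\<open>g \<cdot> f\<close> is ``\<open>g\<close> after \<open>f\<close>''; its value is irrelevant unless \<open>Cod f = Dom g\<close>.\<close>

definition hom :: "('o, 'a) cat \<Rightarrow> 'o \<Rightarrow> 'o \<Rightarrow> 'a set" where
  "hom C A B = {f \<in> Arr C. Dom C f = A \<and> Cod C f = B}"

locale category =
  fixes C :: "('o, 'a) cat" (structure)
  assumes Dom_Obj: "f \<in> Arr C \<Longrightarrow> Dom C f \<in> Obj C"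
    and Cod_Obj: "f \<in> Arr C \<Longrightarrow> Cod C f \<in> Obj C"
    and Id_hom: "A \<in> Obj C \<Longrightarrow> Id C A \<in> hom C A A"
    and Comp_hom: "\<lbrakk>f \<in> hom C A B; g \<in> hom C B D\<rbrakk> \<Longrightarrow> g \<cdot> f \<in> hom C A D"
    and Id_right: "f \<in> hom C A B \<Longrightarrow> f \<cdot> Id C A = f"
    and Id_left: "f \<in> hom C A B \<Longrightarrow> Id C B \<cdot> f = f"
    and Comp_assoc: "\<lbrakk>f \<in> hom C A B; g \<in> hom C B D; h \<in> hom C D E\<rbrakk>
                      \<Longrightarrow> (h \<cdot> g) \<cdot> f = h \<cdot> (g \<cdot> f)"

definition monic :: "('o, 'a) cat \<Rightarrow> 'a \<Rightarrow> bool" where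
  "monic C f \<longleftrightarrow> f \<in> Arr C \<and>
     (\<forall>A. \<forall>g \<in> hom C A (Dom C f). \<forall>h \<in> hom C A (Dom C f). f \<cdot>\<^bsub>C\<^esub> g = f \<cdot>\<^bsub>C\<^esub> h \<longrightarrow> g = h)"

definition epic :: "('o, 'a) cat \<Rightarrow> 'a \<Rightarrow> bool" where
  "epic C f \<longleftrightarrow> f \<in> Arr C \<and>
     (\<forall>B. \<forall>g \<in> hom C (Cod C f) B. \<forall>h \<in> hom C (Cod C f) B. g \<cdot>\<^bsub>C\<^esub> f = h \<cdot>\<^bsub>C\<^esub> f \<longrightarrow> g = h)"

definition is_iso :: "('o, 'a) cat \<Rightarrow> 'a \<Rightarrow> bool" where
  "is_iso C f \<longleftrightarrow> f \<in> Arr C \<and>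
     (\<exists>g \<in> hom C (Cod C f) (Dom C f). g \<cdot>\<^bsub>C\<^esub> f = Id C (Dom C f) \<and> f \<cdot>\<^bsub>C\<^esub> g = Id C (Cod C f))"

definition isomorphic :: "('o, 'a) cat \<Rightarrow> 'o \<Rightarrow> 'o \<Rightarrow> bool" where
  "isomorphic C A B \<longleftrightarrow> (\<exists>f \<in> hom C A B. is_iso C f)"

text \<open>
  All squares are written \<open>f g p q\<close> for \<open>B \<leftarrow>f\<leftarrow> A \<rightarrow>g\<rightarrow> D\<close> and \<open>B \<rightarrow>p\<rightarrow> E \<leftarrow>q\<leftarrow> D\<close> with
  \<open>p \<cdot> f = q \<cdot> g\<close>.
\<close>

definition square :: "('o, 'a) cat \<Rightarrow> 'a \<Rightarrow> 'a \<Rightarrow> 'a \<Rightarrow> 'a \<Rightarrow> bool" where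
  "square C f g p q \<longleftrightarrow>
     f \<in> hom C (Dom C f) (Dom C p) \<and> g \<in> hom C (Dom C f) (Dom C q) \<and>
     p \<in> hom C (Dom C p) (Cod C p) \<and> q \<in> hom C (Dom C q) (Cod C p) \<and>
     p \<cdot>\<^bsub>C\<^esub> f = q \<cdot>\<^bsub>C\<^esub> g"

definition pushout :: "('o, 'a) cat \<Rightarrow> 'a \<Rightarrow> 'a \<Rightarrow> 'a \<Rightarrow> 'a \<Rightarrow> bool" where
  "pushout C f g p q \<longleftrightarrow> square C f g p q \<and>
     (\<forall>p' q'. square C f g p' q' \<longrightarrow>
        (\<exists>!h. h \<in> hom C (Cod C p) (Cod C p') \<and> h \<cdot>\<^bsub>C\<^esub> p = p' \<and> h \<cdot>\<^bsub>C\<^esub> q = q'))"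

definition pullback :: "('o, 'a) cat \<Rightarrow> 'a \<Rightarrow> 'a \<Rightarrow> 'a \<Rightarrow> 'a \<Rightarrow> bool" where
  "pullback C f g p q \<longleftrightarrow> square C f g p q \<and>
     (\<forall>f' g'. square C f' g' p q \<longrightarrow>
        (\<exists>!h. h \<in> hom C (Dom C f') (Dom C f) \<and> f \<cdot>\<^bsub>C\<^esub> h = f' \<and> g \<cdot>\<^bsub>C\<^esub> h = g'))"

text \<open>\<open>K \<rightarrow>k\<rightarrow> K' \<rightarrow>h\<rightarrow> X\<close> is a pushout complement of \<open>K \<rightarrow>f\<rightarrow> I \<rightarrow>m\<rightarrow> X\<close>.\<close>

definition pushout_complement :: "('o, 'a) cat \<Rightarrow> 'a \<Rightarrow> 'a \<Rightarrow> 'a \<Rightarrow> 'a \<Rightarrow> bool" where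
  "pushout_complement C f m k h \<longleftrightarrow> pushout C f k m h"

section \<open>The DPO setting\<close>

text \<open>
  Cube over the pushout \<open>f g p q\<close>, with top face \<open>f' g' p' q'\<close> and vertical \<open>\<M>\<close>-morphisms
  \<open>a, b, c, d\<close>; the faces \<open>f' a b f\<close> and \<open>g' a c g\<close> are the back faces.
\<close>

definition M_van_kampen :: "('o, 'a) cat \<Rightarrow> 'a set \<Rightarrow> 'a \<Rightarrow> 'a \<Rightarrow> 'a \<Rightarrow> 'a \<Rightarrow> bool" where
  "M_van_kampen C M f g p q \<longleftrightarrow> pushout C f g p q \<and>
     (\<forall>f' g' p' q' a b c d.
        a \<in> M \<and> b \<in> M \<and> c \<in> M \<and> d \<in> M \<and>
        square C f' g' p' q' \<and> square C p' b d p \<and> square C q' c d q \<and>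
        pullback C f' a b f \<and> pullback C g' a c g \<longrightarrow>
        (pushout C f' g' p' q' \<longleftrightarrow> pullback C p' b d p \<and> pullback C q' c d q))"

locale M_adhesive = category C for C :: "('o, 'a) cat" (structure) +
  fixes M :: "'a set"
  assumes M_monic: "f \<in> M \<Longrightarrow> monic C f"
    and M_iso: "is_iso C f \<Longrightarrow> f \<in> M"
    and M_comp: "\<lbrakk>f \<in> M; g \<in> M; Cod C f = Dom C g\<rbrakk> \<Longrightarrow> g \<cdot> f \<in> M"
    and M_decomp: "\<lbrakk>f \<in> Arr C; Cod C f = Dom C g; g \<in> M; g \<cdot> f \<in> M\<rbrakk> \<Longrightarrow> f \<in> M"
    and M_pushout_exists: "\<lbrakk>f \<in> M; g \<in> Arr C; Dom C f = Dom C g\<rbrakk> \<Longrightarrow> \<exists>p q. pushout C f g p q"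
    and M_pushout: "\<lbrakk>pushout C f g p q; f \<in> M\<rbrakk> \<Longrightarrow> q \<in> M"
    and M_pullback_exists: "\<lbrakk>p \<in> M; q \<in> Arr C; Cod C p = Cod C q\<rbrakk> \<Longrightarrow> \<exists>f g. pullback C f g p q"
    and M_pullback: "\<lbrakk>pullback C f g p q; p \<in> M\<rbrakk> \<Longrightarrow> g \<in> M"
    and M_vK: "\<lbrakk>pushout C f g p q; f \<in> M\<rbrakk> \<Longrightarrow> M_van_kampen C M f g p q"

definition strict_M_initial :: "('o, 'a) cat \<Rightarrow> 'a set \<Rightarrow> 'o \<Rightarrow> bool" where
  "strict_M_initial C M Z \<longleftrightarrow> Z \<in> Obj C \<and>
     (\<forall>A \<in> Obj C. (\<exists>!f. f \<in> hom C Z A) \<and> hom C Z A \<subseteq> M) \<and>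
     (\<forall>A \<in> Obj C. \<forall>f \<in> hom C A Z. is_iso C f)"

locale dpo_setting = M_adhesive C M for C :: "('o, 'a) cat" (structure) and M :: "'a set" +
  assumes epi_M_factorization:
      "f \<in> Arr C \<Longrightarrow> \<exists>e m. epic C e \<and> m \<in> M \<and> Cod C e = Dom C m \<and> f = m \<cdot> e"
    and balanced: "\<lbrakk>monic C f; epic C f\<rbrakk> \<Longrightarrow> is_iso C f"
    and strict_initial: "\<exists>Z. strict_M_initial C M Z"
    and M_effective_unions:
      "\<lbrakk>f \<in> M; g \<in> M; pushout C f g p q; p' \<in> M; q' \<in> M; pullback C f g p' q';
        h \<in> hom C (Cod C p) (Cod C p'); h \<cdot> p = p'; h \<cdot> q = q'\<rbrakk> \<Longrightarrow> h \<in> M"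

section \<open>Conditions\<close>

text \<open>
  A datatype needs one fixed index type for all its conjunctions. It contains an arbitrary type
  \<open>'i\<close> for the conjunctions in given conditions, pairs of arrows for the disjunctions
  produced by \<open>Shift\<close>, and two further indices for binary conjunctions.
\<close>

datatype ('a, 'i) index = Index 'i | Cospan 'a 'a | Side bool

datatype ('a, 'i) cond =
    CTrue
  | CEx 'a "('a, 'i) cond"
  | CNot "('a, 'i) cond"
  | CConj "('a, 'i) index set" "('a, 'i) index \<Rightarrow> ('a, 'i) cond"

abbreviation CFalse :: "('a, 'i) cond" where
  "CFalse \<equiv> CNot CTrue"

abbreviation CDisj ::
    "('a, 'i) index set \<Rightarrow> (('a, 'i) index \<Rightarrow> ('a, 'i) cond) \<Rightarrow> ('a, 'i) cond" where
  "CDisj J c \<equiv> CNot (CConj J (\<lambda>j. CNot (c j)))"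

definition CAnd :: "('a, 'i) cond \<Rightarrow> ('a, 'i) cond \<Rightarrow> ('a, 'i) cond" where
  "CAnd c d = CConj {Side False, Side True} (\<lambda>j. if j = Side False then c else d)"

primrec cond_over :: "('o, 'a) cat \<Rightarrow> 'a set \<Rightarrow> ('a, 'i) cond \<Rightarrow> 'o \<Rightarrow> bool" where
  "cond_over C M CTrue P \<longleftrightarrow> P \<in> Obj C"
| "cond_over C M (CEx a c) P \<longleftrightarrow> a \<in> M \<and> Dom C a = P \<and> cond_over C M c (Cod C a)"
| "cond_over C M (CNot c) P \<longleftrightarrow> cond_over C M c P"
| "cond_over C M (CConj J c) P \<longleftrightarrow> P \<in> Obj C \<and> (\<forall>j \<in> J. cond_over C M (c j) P)"

primrec sat :: "('o, 'a) cat \<Rightarrow> 'a set \<Rightarrow> ('a, 'i) cond \<Rightarrow> 'a \<Rightarrow> bool" where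
  "sat C M CTrue p \<longleftrightarrow> True"
| "sat C M (CEx a c) p \<longleftrightarrow>
     (\<exists>q \<in> M. q \<in> hom C (Cod C a) (Cod C p) \<and> q \<cdot>\<^bsub>C\<^esub> a = p \<and> sat C M c q)"
| "sat C M (CNot c) p \<longleftrightarrow> \<not> sat C M c p"
| "sat C M (CConj J c) p \<longleftrightarrow> (\<forall>j \<in> J. sat C M (c j) p)"

definition cond_equiv ::
    "('o, 'a) cat \<Rightarrow> 'a set \<Rightarrow> 'o \<Rightarrow> ('a, 'i) cond \<Rightarrow> ('a, 'i) cond \<Rightarrow> bool" where
  "cond_equiv C M P c d \<longleftrightarrow> (\<forall>p \<in> M. Dom C p = P \<longrightarrow> (sat C M c p \<longleftrightarrow> sat C M d p))"

subsection \<open>Shift\<close>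

definition shift_cospans :: "('o, 'a) cat \<Rightarrow> 'a set \<Rightarrow> 'a \<Rightarrow> 'a \<Rightarrow> ('a \<times> 'a) set" where
  "shift_cospans C M p a =
     {(r, s). \<exists>p' \<in> M. \<exists>a' \<in> M. \<exists>x \<in> M. pushout C p' a' r s \<and>
        x \<in> hom C (Dom C p) (Dom C p') \<and> Cod C p' = Cod C p \<and> Cod C a' = Cod C a \<and>
        p' \<cdot>\<^bsub>C\<^esub> x = p \<and> a' \<cdot>\<^bsub>C\<^esub> x = a}"

definition cospan_iso :: "('o, 'a) cat \<Rightarrow> 'a \<times> 'a \<Rightarrow> 'a \<times> 'a \<Rightarrow> bool" where
  "cospan_iso C = (\<lambda>(r, s) (r', s').
     \<exists>e \<in> hom C (Cod C r) (Cod C r'). is_iso C e \<and> e \<cdot>\<^bsub>C\<^esub> r = r' \<and> e \<cdot>\<^bsub>C\<^esub> s = s')"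

text \<open>One chosen representative for each isomorphism class.\<close>

definition shift_reps :: "('o, 'a) cat \<Rightarrow> 'a set \<Rightarrow> 'a \<Rightarrow> 'a \<Rightarrow> ('a \<times> 'a) set" where
  "shift_reps C M p a =
     (\<lambda>E. SOME z. z \<in> E) `
       (shift_cospans C M p a //
         {(z, z'). z \<in> shift_cospans C M p a \<and> z' \<in> shift_cospans C M p a \<and> cospan_iso C z z'})"

primrec Shift :: "('o, 'a) cat \<Rightarrow> 'a set \<Rightarrow> ('a, 'i) cond \<Rightarrow> 'a \<Rightarrow> ('a, 'i) cond" where
  "Shift C M CTrue p = CTrue"
| "Shift C M (CEx a c) p =
     CDisj ((\<lambda>(r, s). Cospan r s) ` shift_reps C M p a)
           (\<lambda>j. case j of Cospan r s \<Rightarrow> CEx r (Shift C M c s) | _ \<Rightarrow> CTrue)"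
| "Shift C M (CNot c) p = CNot (Shift C M c p)"
| "Shift C M (CConj J c) p = CConj J (\<lambda>j. Shift C M (c j) p)"

subsection \<open>Rules and transport\<close>

text \<open>\<open>Rule o i\<close> is the span \<open>O \<leftarrow>o\<leftarrow> K \<rightarrow>i\<rightarrow> I\<close>: the input \<open>I\<close> is on the right.\<close>

datatype 'a rule = Rule (oleg: 'a) (ileg: 'a)

definition linear_rule :: "('o, 'a) cat \<Rightarrow> 'a set \<Rightarrow> 'a rule \<Rightarrow> bool" where
  "linear_rule C M r \<longleftrightarrow> oleg r \<in> M \<and> ileg r \<in> M \<and> Dom C (oleg r) = Dom C (ileg r)"

definition cond_rule :: "('o, 'a) cat \<Rightarrow> 'a set \<Rightarrow> 'a rule \<times> ('a, 'i) cond \<Rightarrow> bool" where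
  "cond_rule C M R \<longleftrightarrow> linear_rule C M (fst R) \<and> cond_over C M (snd R) (Cod C (ileg (fst R)))"

text \<open>
  The chosen data are \<open>K \<rightarrow>k\<rightarrow> K' \<rightarrow>o'\<rightarrow> O'\<close> and \<open>I \<rightarrow>a'\<rightarrow> I' \<leftarrow>i'\<leftarrow> K'\<close>, which are unique up to
  isomorphism in an \<open>\<M>\<close>-adhesive category.
\<close>

primrec Trans :: "('o, 'a) cat \<Rightarrow> ('a, 'i) cond \<Rightarrow> 'a rule \<Rightarrow> ('a, 'i) cond" where
  "Trans C CTrue r = CTrue"
| "Trans C (CEx a c) r =
     (if \<exists>k o'. pushout_complement C (oleg r) a k o'
      then (let (k, o', a', i') = (SOME (k, o', a', i').
                   pushout_complement C (oleg r) a k o' \<and> pushout C (ileg r) k a' i')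
            in CEx a' (Trans C c (Rule o' i')))
      else CFalse)"
| "Trans C (CNot c) r = CNot (Trans C c r)"
| "Trans C (CConj J c) r = CConj J (\<lambda>j. Trans C (c j) r)"

section \<open>DPO rewriting\<close>

definition matches :: "('o, 'a) cat \<Rightarrow> 'a set \<Rightarrow> 'a rule \<Rightarrow> 'o \<Rightarrow> 'a set" where
  "matches C M r X =
     {m \<in> M. m \<in> hom C (Cod C (ileg r)) X \<and> (\<exists>k h. pushout_complement C (ileg r) m k h)}"

definition adm_matches ::
    "('o, 'a) cat \<Rightarrow> 'a set \<Rightarrow> 'a rule \<times> ('a, 'i) cond \<Rightarrow> 'o \<Rightarrow> 'a set" where
  "adm_matches C M R X = {m \<in> matches C M (fst R) X. sat C M (snd R) m}"

text \<open>
  The diagram of a rule application: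
  \<open>O \<leftarrow>o\<leftarrow> K \<rightarrow>i\<rightarrow> I\<close> on top, \<open>Y \<leftarrow>out_emb\<leftarrow> K' \<rightarrow>in_emb\<rightarrow> X\<close> at the bottom, and the vertical
  morphisms \<open>comatch\<close>, \<open>ctxt\<close>, \<open>amatch\<close> from left to right.
\<close>

record 'a dpo =
  amatch :: 'a
  ctxt :: 'a
  in_emb :: 'a
  out_emb :: 'a
  comatch :: 'a

definition dpo_diagram :: "('o, 'a) cat \<Rightarrow> 'a set \<Rightarrow> 'a rule \<Rightarrow> 'a \<Rightarrow> 'o \<Rightarrow> 'a dpo \<Rightarrow> bool" where
  "dpo_diagram C M r m X d \<longleftrightarrow>
     m \<in> M \<and> m \<in> hom C (Cod C (ileg r)) X \<and> amatch d = m \<and>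
     pushout_complement C (ileg r) m (ctxt d) (in_emb d) \<and>
     pushout C (oleg r) (ctxt d) (comatch d) (out_emb d)"

abbreviation result :: "('o, 'a) cat \<Rightarrow> 'a dpo \<Rightarrow> 'o" where
  "result C d \<equiv> Cod C (comatch d)"

text \<open>\<open>Y = r_m(X)\<close>; as usual this determines \<open>Y\<close> only up to isomorphism.\<close>

definition dpo_step :: "('o, 'a) cat \<Rightarrow> 'a set \<Rightarrow> 'a rule \<Rightarrow> 'a \<Rightarrow> 'o \<Rightarrow> 'o \<Rightarrow> bool" where
  "dpo_step C M r m X Y \<longleftrightarrow> (\<exists>d. dpo_diagram C M r m X d \<and> result C d = Y)"

section \<open>Composition of rules\<close>

text \<open>
  Over a span \<open>I\<^sub>2 \<leftarrow> M\<^sub>2\<^sub>1 \<rightarrow> O\<^sub>1\<close>: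
  \<open>I\<^sub>2 \<rightarrow>nI\<rightarrow> N\<^sub>2\<^sub>1 \<leftarrow>nO\<leftarrow> O\<^sub>1\<close>, the pushout complements
  \<open>K\<^sub>2 \<rightarrow>k2\<rightarrow> K\<^sub>2' \<rightarrow>g2\<rightarrow> N\<^sub>2\<^sub>1\<close> and \<open>K\<^sub>1 \<rightarrow>k1\<rightarrow> K\<^sub>1' \<rightarrow>g1\<rightarrow> N\<^sub>2\<^sub>1\<close>,
  the pushouts \<open>O\<^sub>2 \<rightarrow>pO\<rightarrow> O\<^sub>2\<^sub>1 \<leftarrow>eO\<leftarrow> K\<^sub>2'\<close> and \<open>I\<^sub>1 \<rightarrow>pI\<rightarrow> I\<^sub>2\<^sub>1 \<leftarrow>eI\<leftarrow> K\<^sub>1'\<close>,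
  and the pullback \<open>K\<^sub>2' \<leftarrow>x2\<leftarrow> K\<^sub>2\<^sub>1 \<rightarrow>x1\<rightarrow> K\<^sub>1'\<close>.
\<close>

record 'a composition =
  nI :: 'a
  nO :: 'a
  k2 :: 'a
  g2 :: 'a
  k1 :: 'a
  g1 :: 'a
  pO :: 'a
  eO :: 'a
  pI :: 'a
  eI :: 'a
  x2 :: 'a
  x1 :: 'a

definition comp_diagram ::
    "('o, 'a) cat \<Rightarrow> 'a set \<Rightarrow> 'a rule \<Rightarrow> 'a rule \<Rightarrow> 'a \<times> 'a \<Rightarrow> 'a composition \<Rightarrow> bool" where
  "comp_diagram C M r2 r1 \<mu> D \<longleftrightarrow>
     fst \<mu> \<in> M \<and> snd \<mu> \<in> M \<and>
     Cod C (fst \<mu>) = Cod C (ileg r2) \<and> Cod C (snd \<mu>) = Cod C (oleg r1) \<and>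
     pushout C (fst \<mu>) (snd \<mu>) (nI D) (nO D) \<and>
     pushout_complement C (ileg r2) (nI D) (k2 D) (g2 D) \<and>
     pushout_complement C (oleg r1) (nO D) (k1 D) (g1 D) \<and>
     pushout C (oleg r2) (k2 D) (pO D) (eO D) \<and>
     pushout C (ileg r1) (k1 D) (pI D) (eI D) \<and>
     pullback C (x2 D) (x1 D) (g2 D) (g1 D)"

definition composite ::
    "('o, 'a) cat \<Rightarrow> 'a set \<Rightarrow> 'a rule \<times> ('a, 'i) cond \<Rightarrow> 'a rule \<times> ('a, 'i) cond \<Rightarrow>
     'a composition \<Rightarrow> 'a rule \<times> ('a, 'i) cond" where
  "composite C M R2 R1 D =
     (Rule (eO D \<cdot>\<^bsub>C\<^esub> x2 D) (eI D \<cdot>\<^bsub>C\<^esub> x1 D),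
      CAnd (Shift C M (snd R1) (pI D))
           (Trans C (Shift C M (snd R2) (nI D)) (Rule (g1 D) (eI D))))"

text \<open>The admissible matches of \<open>R\<^sub>2\<close> into \<open>R\<^sub>1\<close>.\<close>

definition comp_matches ::
    "('o, 'a) cat \<Rightarrow> 'a set \<Rightarrow> 'a rule \<times> ('a, 'i) cond \<Rightarrow> 'a rule \<times> ('a, 'i) cond \<Rightarrow>
     ('a \<times> 'a) set" where
  "comp_matches C M R2 R1 =
     {\<mu>. \<exists>D. comp_diagram C M (fst R2) (fst R1) \<mu> D \<and>
          \<not> cond_equiv C M (Cod C (pI D)) (snd (composite C M R2 R1 D)) CFalse}"

definition span_iso :: "('o, 'a) cat \<Rightarrow> 'a \<times> 'a \<Rightarrow> 'a \<times> 'a \<Rightarrow> bool" where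
  "span_iso C = (\<lambda>(u, v) (u', v').
     \<exists>e \<in> hom C (Dom C u) (Dom C u'). is_iso C e \<and> u' \<cdot>\<^bsub>C\<^esub> e = u \<and> v' \<cdot>\<^bsub>C\<^esub> e = v)"

text \<open>
  How the match \<open>m21\<close> of the composite arises from a sequence: \<open>d\<close> is the application of
  \<open>r\<^sub>1\<close> to \<open>X\<^sub>0\<close>, with context object \<open>L\<close> and result \<open>X\<^sub>1\<close>, and \<open>m2 : I\<^sub>2 \<rightarrow> X\<^sub>1\<close>.
  The span \<open>\<mu>\<close> is the overlap (pullback) of \<open>m2\<close> with the comatch \<open>O\<^sub>1 \<rightarrow> X\<^sub>1\<close>;
  \<open>n : N\<^sub>2\<^sub>1 \<rightarrow> X\<^sub>1\<close> is induced by these two, \<open>l : K\<^sub>1' \<rightarrow> L\<close> is its restriction to the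
  context objects, and \<open>m21 : I\<^sub>2\<^sub>1 \<rightarrow> X\<^sub>0\<close> is induced by the first match and \<open>l\<close>.
  Conversely the second match is recovered as \<open>n \<cdot> nI\<close> and the first one as \<open>m21 \<cdot> pI\<close>.
\<close>

definition concurrent ::
    "('o, 'a) cat \<Rightarrow> 'a dpo \<Rightarrow> 'a \<Rightarrow> 'a \<times> 'a \<Rightarrow> 'a composition \<Rightarrow> 'a \<Rightarrow> bool" where
  "concurrent C d m2 \<mu> D m21 \<longleftrightarrow>
     pullback C (fst \<mu>) (snd \<mu>) m2 (comatch d) \<and>
     (\<exists>n \<in> hom C (Cod C (nI D)) (result C d). \<exists>l \<in> hom C (Cod C (k1 D)) (Cod C (ctxt d)).
        n \<cdot>\<^bsub>C\<^esub> nI D = m2 \<and> n \<cdot>\<^bsub>C\<^esub> nO D = comatch d \<and>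
        l \<cdot>\<^bsub>C\<^esub> k1 D = ctxt d \<and> out_emb d \<cdot>\<^bsub>C\<^esub> l = n \<cdot>\<^bsub>C\<^esub> g1 D \<and>
        m21 \<cdot>\<^bsub>C\<^esub> pI D = amatch d \<and> m21 \<cdot>\<^bsub>C\<^esub> eI D = in_emb d \<cdot>\<^bsub>C\<^esub> l)"

end

theory Submission
  imports Defs
begin

text \<open>
  Everything is pasting and decomposition of pushouts. Given an application of \<open>r\<^sub>1\<close> to \<open>X\<^sub>0\<close> with result \<open>X\<^sub>1\<close>
  and a match \<open>m\<^sub>2\<close> of \<open>r\<^sub>2\<close> in \<open>X\<^sub>1\<close>, let \<open>\<mu>\<close> be the pullback of \<open>m\<^sub>2\<close> and the comatch. By effective unions the
  induced \<open>n : N\<^sub>2\<^sub>1 \<rightarrow> X\<^sub>1\<close> lies in \<open>\<M>\<close>, and pushout complements restrict along \<open>n\<close>, so both steps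
  factor through \<open>N\<^sub>2\<^sub>1\<close>. The \<open>\<M>\<close>-van Kampen property makes the pullback over \<open>X\<^sub>1\<close> of the two context
  objects the context object of an application of the composite rule. Conversely, the context objects
  of the two steps arise by pushing out that of the composite along \<open>K\<^sub>2\<^sub>1 \<rightarrow> K\<^sub>1'\<close> and \<open>K\<^sub>2\<^sub>1 \<rightarrow> K\<^sub>2'\<close>.
  A morphism \<open>n\<close> satisfies \<open>Shift(p, c)\<close> iff \<open>n \<cdot> p\<close> satisfies \<open>c\<close>, and a match satisfies \<open>Trans(r, c)\<close> iff its
  comatch satisfies \<open>c\<close>. The pairs \<open>(\<mu>, m\<^sub>2\<^sub>1)\<close> and \<open>(m\<^sub>1, m\<^sub>2)\<close> determine each other since the embeddings of
  the context objects are monic and \<open>N\<^sub>2\<^sub>1\<close>, \<open>I\<^sub>2\<^sub>1\<close> are pushouts.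
\<close>

section \<open>Pushouts and pullbacks\<close>

context category
begin

lemma homI: "f \<in> Arr C \<Longrightarrow> Dom C f = A \<Longrightarrow> Cod C f = B \<Longrightarrow> f \<in> hom C A B"
  by (simp add: hom_def)

lemma comp_in_hom:
  assumes "f \<in> Arr C" "g \<in> Arr C" "Cod C f = Dom C g"
  shows "g \<cdot> f \<in> hom C (Dom C f) (Cod C g)"
  using Comp_hom[of f "Dom C f" "Cod C f" g "Cod C g"] assms by (simp add: hom_def)

lemma comp_simps [simp]:
  assumes "f \<in> Arr C" "g \<in> Arr C" "Cod C f = Dom C g"
  shows "g \<cdot> f \<in> Arr C" "Dom C (g \<cdot> f) = Dom C f" "Cod C (g \<cdot> f) = Cod C g"
  using comp_in_hom[OF assms] by (simp_all add: hom_def)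

lemma comp_assoc:
  assumes "f \<in> Arr C" "g \<in> Arr C" "h \<in> Arr C" "Cod C f = Dom C g" "Cod C g = Dom C h"
  shows "(h \<cdot> g) \<cdot> f = h \<cdot> (g \<cdot> f)"
  using Comp_assoc[of f "Dom C f" "Dom C g" g "Dom C h" h "Cod C h"] assms by (simp add: hom_def)

lemma Id_simps [simp]:
  assumes "A \<in> Obj C"
  shows "Id C A \<in> Arr C" "Dom C (Id C A) = A" "Cod C (Id C A) = A"
  using Id_hom[OF assms] by (simp_all add: hom_def)

lemma Id_comp [simp]:
  assumes "f \<in> Arr C"
  shows "Cod C f = A \<Longrightarrow> Id C A \<cdot> f = f" "Dom C f = A \<Longrightarrow> f \<cdot> Id C A = f"
  using Id_left[of f] Id_right[of f] assms by (auto simp: hom_def)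

lemma square_iff:
  "square C f g p q \<longleftrightarrow> f \<in> Arr C \<and> g \<in> Arr C \<and> p \<in> Arr C \<and> q \<in> Arr C \<and>
     Dom C g = Dom C f \<and> Cod C f = Dom C p \<and> Cod C g = Dom C q \<and> Cod C q = Cod C p \<and>
     p \<cdot> f = q \<cdot> g"
  by (auto simp: square_def hom_def)

lemma square_sym: "square C f g p q \<Longrightarrow> square C g f q p"
  by (auto simp: square_iff)

lemma square_comp:
  assumes "square C f g p q" "h \<in> Arr C" "Cod C h = Dom C f"
  shows "p \<cdot> (f \<cdot> h) = q \<cdot> (g \<cdot> h)"
proof -
  have "p \<cdot> (f \<cdot> h) = (p \<cdot> f) \<cdot> h" using assms by (simp add: square_iff comp_assoc[symmetric])
  also have "\<dots> = (q \<cdot> g) \<cdot> h" using assms(1) by (simp add: square_iff)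
  also have "\<dots> = q \<cdot> (g \<cdot> h)" using assms by (simp add: square_iff comp_assoc)
  finally show ?thesis .
qed

lemma pushout_square: "pushout C f g p q \<Longrightarrow> square C f g p q"
  by (simp add: pushout_def)

lemma pullback_square: "pullback C f g p q \<Longrightarrow> square C f g p q"
  by (simp add: pullback_def)

section \<open>Universal properties, with existence and uniqueness of mediating morphisms
  separated\<close>

lemma pushoutI:
  assumes "square C f g p q"
    and "\<And>p' q'. square C f g p' q' \<Longrightarrow>
      \<exists>h \<in> Arr C. Dom C h = Cod C p \<and> Cod C h = Cod C p' \<and> h \<cdot> p = p' \<and> h \<cdot> q = q'"
    and "\<And>h h'. \<lbrakk>h \<in> Arr C; h' \<in> Arr C; Dom C h = Cod C p; Dom C h' = Cod C p;
      Cod C h = Cod C h'; h \<cdot> p = h' \<cdot> p; h \<cdot> q = h' \<cdot> q\<rbrakk> \<Longrightarrow> h = h'"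
  shows "pushout C f g p q"
  unfolding pushout_def
proof (intro conjI allI impI assms(1))
  fix p' q' assume "square C f g p' q'"
  from assms(2)[OF this] obtain h where
    "h \<in> Arr C" "Dom C h = Cod C p" "Cod C h = Cod C p'" "h \<cdot> p = p'" "h \<cdot> q = q'" by blast
  then show "\<exists>!h. h \<in> hom C (Cod C p) (Cod C p') \<and> h \<cdot> p = p' \<and> h \<cdot> q = q'"
    using assms(3) by (intro ex1I[of _ h]) (auto simp: hom_def)
qed

lemma pushout_ex:
  assumes "pushout C f g p q" "square C f g p' q'"
  shows "\<exists>h \<in> Arr C. Dom C h = Cod C p \<and> Cod C h = Cod C p' \<and> h \<cdot> p = p' \<and> h \<cdot> q = q'"
  using assms unfolding pushout_def hom_def by blast

lemma pushout_eq:
  assumes "pushout C f g p q" "h \<in> Arr C" "h' \<in> Arr C" "Dom C h = Cod C p" "Dom C h' = Cod C p"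
    "h \<cdot> p = h' \<cdot> p" "h \<cdot> q = h' \<cdot> q"
  shows "h = h'"
proof -
  have sq: "square C f g p q" using assms(1) by (rule pushout_square)
  \<comment> \<open>Equality of the two codomains is not among the hypotheses; it follows from
    \<open>h \<cdot> p = h' \<cdot> p\<close>.\<close>
  have "Cod C h = Cod C (h \<cdot> p)" "Cod C h' = Cod C (h' \<cdot> p)"
    using assms(2-5) sq by (simp_all add: square_iff)
  then have cod: "Cod C h' = Cod C h" by (simp only: assms(6))
  have "square C f g (h \<cdot> p) (h \<cdot> q)"
    using sq assms by (simp add: square_iff comp_assoc)
  then have "\<exists>!k. k \<in> hom C (Cod C p) (Cod C (h \<cdot> p)) \<and> k \<cdot> p = h \<cdot> p \<and> k \<cdot> q = h \<cdot> q"
    using assms(1) unfolding pushout_def by blast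
  moreover have "Cod C (h \<cdot> p) = Cod C h" using assms(2-5) sq by (auto simp: square_iff)
  ultimately show ?thesis using assms cod unfolding hom_def by auto
qed

lemma pullbackI:
  assumes "square C f g p q"
    and "\<And>f' g'. square C f' g' p q \<Longrightarrow>
      \<exists>h \<in> Arr C. Dom C h = Dom C f' \<and> Cod C h = Dom C f \<and> f \<cdot> h = f' \<and> g \<cdot> h = g'"
    and "\<And>h h'. \<lbrakk>h \<in> Arr C; h' \<in> Arr C; Cod C h = Dom C f; Cod C h' = Dom C f;
      Dom C h = Dom C h'; f \<cdot> h = f \<cdot> h'; g \<cdot> h = g \<cdot> h'\<rbrakk> \<Longrightarrow> h = h'"
  shows "pullback C f g p q"
  unfolding pullback_def
proof (intro conjI allI impI assms(1))
  fix f' g' assume "square C f' g' p q"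
  from assms(2)[OF this] obtain h where
    "h \<in> Arr C" "Dom C h = Dom C f'" "Cod C h = Dom C f" "f \<cdot> h = f'" "g \<cdot> h = g'" by blast
  then show "\<exists>!h. h \<in> hom C (Dom C f') (Dom C f) \<and> f \<cdot> h = f' \<and> g \<cdot> h = g'"
    using assms(3) by (intro ex1I[of _ h]) (auto simp: hom_def)
qed

lemma pullback_ex:
  assumes "pullback C f g p q" "square C f' g' p q"
  shows "\<exists>h \<in> Arr C. Dom C h = Dom C f' \<and> Cod C h = Dom C f \<and> f \<cdot> h = f' \<and> g \<cdot> h = g'"
  using assms unfolding pullback_def hom_def by blast

lemma pullback_eq:
  assumes "pullback C f g p q" "h \<in> Arr C" "h' \<in> Arr C" "Cod C h = Dom C f" "Cod C h' = Dom C f"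
    "f \<cdot> h = f \<cdot> h'" "g \<cdot> h = g \<cdot> h'"
  shows "h = h'"
proof -
  have sq: "square C f g p q" using assms(1) by (rule pullback_square)
  have "Dom C h = Dom C (f \<cdot> h)" "Dom C h' = Dom C (f \<cdot> h')"
    using assms(2-5) sq by (simp_all add: square_iff)
  then have dom: "Dom C h' = Dom C h" by (simp only: assms(6))
  have "square C (f \<cdot> h) (g \<cdot> h) p q"
    using sq assms by (simp add: square_iff comp_assoc[symmetric])
  then have "\<exists>!k. k \<in> hom C (Dom C (f \<cdot> h)) (Dom C f) \<and> f \<cdot> k = f \<cdot> h \<and> g \<cdot> k = g \<cdot> h"
    using assms(1) unfolding pullback_def by blast
  moreover have "Dom C (f \<cdot> h) = Dom C h" using assms(2-5) sq by (auto simp: square_iff)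
  ultimately show ?thesis using assms dom unfolding hom_def by auto
qed

lemma pushout_sym:
  assumes "pushout C f g p q"
  shows "pushout C g f q p"
proof (rule pushoutI)
  have sq: "square C f g p q" using assms by (rule pushout_square)
  then show "square C g f q p" by (rule square_sym)
  fix q' p' assume "square C g f q' p'"
  from square_sym[OF this] pushout_ex[OF assms square_sym[OF this]]
  show "\<exists>h\<in>Arr C. Dom C h = Cod C q \<and> Cod C h = Cod C q' \<and> h \<cdot> q = q' \<and> h \<cdot> p = p'"
    using sq by (auto simp: square_iff)
next
  fix h h' assume "h \<in> Arr C" "h' \<in> Arr C" "Dom C h = Cod C q" "Dom C h' = Cod C q"
      "h \<cdot> q = h' \<cdot> q" "h \<cdot> p = h' \<cdot> p"
  then show "h = h'" using pushout_eq[OF assms, of h h'] pushout_square[OF assms]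
    by (auto simp: square_iff)
qed

lemma pullback_sym:
  assumes "pullback C f g p q"
  shows "pullback C g f q p"
proof (rule pullbackI)
  have sq: "square C f g p q" using assms by (rule pullback_square)
  then show "square C g f q p" by (rule square_sym)
  fix g' f' assume "square C g' f' q p"
  from square_sym[OF this] pullback_ex[OF assms square_sym[OF this]]
  show "\<exists>h\<in>Arr C. Dom C h = Dom C g' \<and> Cod C h = Dom C g \<and> g \<cdot> h = g' \<and> f \<cdot> h = f'"
    using sq by (auto simp: square_iff)
next
  fix h h' assume "h \<in> Arr C" "h' \<in> Arr C" "Cod C h = Dom C g" "Cod C h' = Dom C g"
      "g \<cdot> h = g \<cdot> h'" "f \<cdot> h = f \<cdot> h'"
  then show "h = h'" using pullback_eq[OF assms, of h h'] pullback_square[OF assms]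
    by (auto simp: square_iff)
qed

section \<open>Pasting and decomposition of pushouts and pullbacks\<close>

lemma pushout_paste:
  assumes P: "pushout C f k m h" and Q: "pushout C h l n j"
  shows "pushout C f (l \<cdot> k) (n \<cdot> m) j"
proof (rule pushoutI)
  have P': "square C f k m h" and Q': "square C h l n j"
    using assms by (auto dest: pushout_square)
  then have "(n \<cdot> m) \<cdot> f = n \<cdot> (h \<cdot> k)" by (simp add: square_iff comp_assoc)
  also have "\<dots> = j \<cdot> (l \<cdot> k)" using P' square_comp[OF Q'] by (simp add: square_iff)
  finally show "square C f (l \<cdot> k) (n \<cdot> m) j" using P' Q' by (simp add: square_iff)
  fix p' q' assume S: "square C f (l \<cdot> k) p' q'"
  then have "square C f k p' (q' \<cdot> l)" using P' Q' by (simp add: square_iff comp_assoc)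
  from pushout_ex[OF P this] obtain t where
    t: "t \<in> Arr C" "Dom C t = Cod C m" "Cod C t = Cod C p'" "t \<cdot> m = p'" "t \<cdot> h = q' \<cdot> l" by blast
  then have "square C h l t q'" using S P' Q' by (simp add: square_iff)
  from pushout_ex[OF Q this] obtain s where
    s: "s \<in> Arr C" "Dom C s = Cod C n" "Cod C s = Cod C t" "s \<cdot> n = t" "s \<cdot> j = q'" by blast
  have "s \<cdot> (n \<cdot> m) = p'" using s t P' Q' by (simp add: square_iff comp_assoc[symmetric])
  then show "\<exists>s\<in>Arr C. Dom C s = Cod C (n \<cdot> m) \<and> Cod C s = Cod C p' \<and> s \<cdot> (n \<cdot> m) = p' \<and> s \<cdot> j = q'"
    using s t P' Q' by (auto simp: square_iff)
next
  fix s s' assume H: "s \<in> Arr C" "s' \<in> Arr C" "Dom C s = Cod C (n \<cdot> m)" "Dom C s' = Cod C (n \<cdot> m)"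
      "Cod C s = Cod C s'" "s \<cdot> (n \<cdot> m) = s' \<cdot> (n \<cdot> m)" "s \<cdot> j = s' \<cdot> j"
  have P': "square C f k m h" and Q': "square C h l n j"
    using assms by (auto dest: pushout_square)
  have d: "Dom C s = Cod C n" "Dom C s' = Cod C n" using H P' Q' by (auto simp: square_iff)
  have "(s \<cdot> n) \<cdot> m = (s' \<cdot> n) \<cdot> m" using H d P' Q' by (simp add: square_iff comp_assoc)
  moreover have "(s \<cdot> n) \<cdot> h = (s \<cdot> j) \<cdot> l" "(s' \<cdot> n) \<cdot> h = (s' \<cdot> j) \<cdot> l"
    using H(1,2) d P' Q' by (simp_all add: square_iff comp_assoc)
  ultimately have "s \<cdot> n = s' \<cdot> n"
    using pushout_eq[OF P, of "s \<cdot> n" "s' \<cdot> n"] H(1,2,7) d P' Q' by (simp add: square_iff)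
  then show "s = s'" using pushout_eq[OF Q, of s s'] H(1,2,7) d by simp
qed

text \<open>The morphism \<open>n\<close> is induced by \<open>w\<close> and
  \<open>j \<cdot> l\<close>. A cocone over the second square becomes, after composing with
  \<open>m\<close>, a cocone over the whole rectangle, and the mediating morphism of the rectangle
  serves for the second square too.\<close>

lemma pushout_decomp:
  assumes P: "pushout C f k m h" and W: "pushout C f (l \<cdot> k) w j"
    and l: "l \<in> Arr C" "Dom C l = Cod C k"
  shows "\<exists>n. n \<cdot> m = w \<and> pushout C h l n j"
proof -
  have P': "square C f k m h" and W': "square C f (l \<cdot> k) w j"
    using P W by (auto dest: pushout_square)
  then have "square C f k w (j \<cdot> l)" using l by (simp add: square_iff comp_assoc)
  from pushout_ex[OF P this] obtain n where
    n: "n \<in> Arr C" "Dom C n = Cod C m" "Cod C n = Cod C w" "n \<cdot> m = w" "n \<cdot> h = j \<cdot> l" by blast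
  have "pushout C h l n j"
  proof (rule pushoutI)
    show "square C h l n j" using n P' W' l by (simp add: square_iff)
    fix p' q' assume S: "square C h l p' q'"
    have "(p' \<cdot> m) \<cdot> f = p' \<cdot> (h \<cdot> k)" using S P' by (simp add: square_iff comp_assoc)
    also have "\<dots> = q' \<cdot> (l \<cdot> k)" using P' square_comp[OF S] by (simp add: square_iff)
    finally have "square C f (l \<cdot> k) (p' \<cdot> m) q'" using S P' l by (simp add: square_iff)
    from pushout_ex[OF W this] obtain s where s: "s \<in> Arr C" "Dom C s = Cod C w"
      "Cod C s = Cod C (p' \<cdot> m)" "s \<cdot> w = p' \<cdot> m" "s \<cdot> j = q'" by blast
    have "(s \<cdot> n) \<cdot> m = p' \<cdot> m" using s n P' W' by (simp add: square_iff comp_assoc)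
    moreover have "(s \<cdot> n) \<cdot> h = (s \<cdot> j) \<cdot> l" using s(1-3) n P' W' l
      by (simp add: square_iff comp_assoc)
    moreover have "\<dots> = p' \<cdot> h" using s S by (simp add: square_iff)
    ultimately have "s \<cdot> n = p'"
      using pushout_eq[OF P, of "s \<cdot> n" p'] s n S P' by (simp add: square_iff)
    then show "\<exists>s\<in>Arr C. Dom C s = Cod C n \<and> Cod C s = Cod C p' \<and> s \<cdot> n = p' \<and> s \<cdot> j = q'"
      using s n S P' by (auto simp: square_iff)
  next
    fix s s' assume H: "s \<in> Arr C" "s' \<in> Arr C" "Dom C s = Cod C n" "Dom C s' = Cod C n"
        "s \<cdot> n = s' \<cdot> n" "s \<cdot> j = s' \<cdot> j"
    have "s \<cdot> w = (s \<cdot> n) \<cdot> m" "s' \<cdot> w = (s' \<cdot> n) \<cdot> m"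
      using H(1-4) n P' by (simp_all add: square_iff comp_assoc)
    then show "s = s'" using pushout_eq[OF W, of s s'] H n by simp
  qed
  with n show ?thesis by blast
qed

lemma pullback_paste:
  assumes P: "pullback C f k m h" and Q: "pullback C h l n j"
  shows "pullback C f (l \<cdot> k) (n \<cdot> m) j"
proof (rule pullbackI)
  have P': "square C f k m h" and Q': "square C h l n j"
    using assms by (auto dest: pullback_square)
  then have "(n \<cdot> m) \<cdot> f = n \<cdot> (h \<cdot> k)" by (simp add: square_iff comp_assoc)
  also have "\<dots> = j \<cdot> (l \<cdot> k)" using P' square_comp[OF Q'] by (simp add: square_iff)
  finally show "square C f (l \<cdot> k) (n \<cdot> m) j" using P' Q' by (simp add: square_iff)
  fix f' g' assume S: "square C f' g' (n \<cdot> m) j"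
  have "square C (m \<cdot> f') g' n j" using S P' Q' by (auto simp: square_iff comp_assoc)
  from pullback_ex[OF Q this] obtain t where
    t: "t \<in> Arr C" "Dom C t = Dom C (m \<cdot> f')" "Cod C t = Dom C h" "h \<cdot> t = m \<cdot> f'" "l \<cdot> t = g'"
    by blast
  then have "square C f' t m h" using S P' Q' by (auto simp: square_iff)
  from pullback_ex[OF P this] obtain s where
    s: "s \<in> Arr C" "Dom C s = Dom C f'" "Cod C s = Dom C f" "f \<cdot> s = f'" "k \<cdot> s = t" by blast
  have "(l \<cdot> k) \<cdot> s = g'" using s t P' Q' by (simp add: square_iff comp_assoc)
  then show "\<exists>s\<in>Arr C. Dom C s = Dom C f' \<and> Cod C s = Dom C f \<and> f \<cdot> s = f' \<and> (l \<cdot> k) \<cdot> s = g'"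
    using s by auto
next
  fix s s' assume H: "s \<in> Arr C" "s' \<in> Arr C" "Cod C s = Dom C f" "Cod C s' = Dom C f"
      "Dom C s = Dom C s'" "f \<cdot> s = f \<cdot> s'" "(l \<cdot> k) \<cdot> s = (l \<cdot> k) \<cdot> s'"
  have P': "square C f k m h" and Q': "square C h l n j"
    using assms by (auto dest: pullback_square)
  have "l \<cdot> (k \<cdot> s) = l \<cdot> (k \<cdot> s')" using H P' Q' by (simp add: square_iff comp_assoc)
  moreover have "h \<cdot> (k \<cdot> s) = m \<cdot> (f \<cdot> s)" "h \<cdot> (k \<cdot> s') = m \<cdot> (f \<cdot> s')"
    using H(1-5) P' Q' by (simp_all add: square_iff comp_assoc[symmetric])
  ultimately have "k \<cdot> s = k \<cdot> s'"
    using pullback_eq[OF Q, of "k \<cdot> s" "k \<cdot> s'"] H P' Q' by (simp add: square_iff)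
  then show "s = s'" using pullback_eq[OF P, of s s'] H by simp
qed

text \<open>Dual to \<open>pushout_decomp\<close>: here \<open>k\<close> is induced by
  \<open>m \<cdot> f\<close> and \<open>w\<close>.\<close>

lemma pullback_decomp:
  assumes Q: "pullback C h l n j" and W: "pullback C f w (n \<cdot> m) j"
    and m: "m \<in> Arr C" "Cod C m = Dom C n"
  shows "\<exists>k. l \<cdot> k = w \<and> pullback C f k m h"
proof -
  have Q': "square C h l n j" and W': "square C f w (n \<cdot> m) j"
    using Q W by (auto dest: pullback_square)
  then have "square C (m \<cdot> f) w n j" using m by (auto simp: square_iff comp_assoc)
  from pullback_ex[OF Q this] obtain k where k: "k \<in> Arr C" "Dom C k = Dom C (m \<cdot> f)"
    "Cod C k = Dom C h" "h \<cdot> k = m \<cdot> f" "l \<cdot> k = w" by blast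
  have "pullback C f k m h"
  proof (rule pullbackI)
    show "square C f k m h" using k Q' W' m by (auto simp: square_iff)
    fix f' g' assume S: "square C f' g' m h"
    have "(n \<cdot> m) \<cdot> f' = n \<cdot> (h \<cdot> g')" using S Q' m by (simp add: square_iff comp_assoc)
    also have "\<dots> = j \<cdot> (l \<cdot> g')" using S square_comp[OF Q'] by (simp add: square_iff)
    finally have "square C f' (l \<cdot> g') (n \<cdot> m) j" using S Q' m by (simp add: square_iff)
    from pullback_ex[OF W this] obtain s where s: "s \<in> Arr C" "Dom C s = Dom C f'"
      "Cod C s = Dom C f" "f \<cdot> s = f'" "w \<cdot> s = l \<cdot> g'" by blast
    have "l \<cdot> (k \<cdot> s) = l \<cdot> g'" using s k Q' W' m by (simp add: square_iff comp_assoc[symmetric])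
    moreover have "h \<cdot> (k \<cdot> s) = m \<cdot> (f \<cdot> s)" using s(1-3) k Q' W' m
      by (simp add: square_iff comp_assoc[symmetric])
    moreover have "\<dots> = h \<cdot> g'" using s S by (simp add: square_iff)
    ultimately have "k \<cdot> s = g'"
      using pullback_eq[OF Q, of "k \<cdot> s" g'] s k S Q' W' m by (simp add: square_iff)
    then show "\<exists>s\<in>Arr C. Dom C s = Dom C f' \<and> Cod C s = Dom C f \<and> f \<cdot> s = f' \<and> k \<cdot> s = g'"
      using s by auto
  next
    fix s s' assume H: "s \<in> Arr C" "s' \<in> Arr C" "Cod C s = Dom C f" "Cod C s' = Dom C f"
        "f \<cdot> s = f \<cdot> s'" "k \<cdot> s = k \<cdot> s'"
    have "w \<cdot> s = l \<cdot> (k \<cdot> s)" "w \<cdot> s' = l \<cdot> (k \<cdot> s')"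
      using H(1-4) k Q' W' m by (simp_all add: square_iff comp_assoc[symmetric])
    then show "s = s'" using pullback_eq[OF W, of s s'] H by simp
  qed
  with k show ?thesis by blast
qed

section \<open>Isomorphisms, and pullbacks up to isomorphism of spans\<close>

lemma is_isoE:
  assumes "is_iso C f"
  obtains g where "f \<in> Arr C" "g \<in> Arr C" "Dom C g = Cod C f" "Cod C g = Dom C f"
    "g \<cdot> f = Id C (Dom C f)" "f \<cdot> g = Id C (Cod C f)"
  using assms unfolding is_iso_def hom_def by auto

lemma is_isoI:
  assumes "f \<in> Arr C" "g \<in> Arr C" "Dom C g = Cod C f" "Cod C g = Dom C f"
    "g \<cdot> f = Id C (Dom C f)" "f \<cdot> g = Id C (Cod C f)"
  shows "is_iso C f"
  using assms unfolding is_iso_def hom_def by auto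

lemma is_iso_inverse:
  assumes "is_iso C c"
  obtains d where "is_iso C d" "c \<in> Arr C" "d \<in> Arr C" "Dom C d = Cod C c" "Cod C d = Dom C c"
    "d \<cdot> c = Id C (Dom C c)" "c \<cdot> d = Id C (Cod C c)"
proof -
  from assms obtain d where d: "c \<in> Arr C" "d \<in> Arr C" "Dom C d = Cod C c" "Cod C d = Dom C c"
    "d \<cdot> c = Id C (Dom C c)" "c \<cdot> d = Id C (Cod C c)" by (rule is_isoE)
  then have "is_iso C d" by (intro is_isoI[of d c]) auto
  with d show thesis using that by blast
qed

lemma is_iso_Id: "A \<in> Obj C \<Longrightarrow> is_iso C (Id C A)"
  by (rule is_isoI[of _ "Id C A"]) auto

lemma isomorphicI: "is_iso C f \<Longrightarrow> Dom C f = A \<Longrightarrow> Cod C f = B \<Longrightarrow> isomorphic C A B"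
  by (auto simp: isomorphic_def hom_def is_iso_def)

lemma is_iso_comp:
  assumes "is_iso C f" "is_iso C g" "Cod C f = Dom C g"
  shows "is_iso C (g \<cdot> f)"
proof -
  from assms(1) obtain f' where f: "f \<in> Arr C" "f' \<in> Arr C" "Dom C f' = Cod C f"
    "Cod C f' = Dom C f" "f' \<cdot> f = Id C (Dom C f)" "f \<cdot> f' = Id C (Cod C f)" by (rule is_isoE)
  from assms(2) obtain g' where g: "g \<in> Arr C" "g' \<in> Arr C" "Dom C g' = Cod C g"
    "Cod C g' = Dom C g" "g' \<cdot> g = Id C (Dom C g)" "g \<cdot> g' = Id C (Cod C g)" by (rule is_isoE)
  have "(f' \<cdot> g') \<cdot> (g \<cdot> f) = f' \<cdot> ((g' \<cdot> g) \<cdot> f)" "(g \<cdot> f) \<cdot> (f' \<cdot> g') = g \<cdot> ((f \<cdot> f') \<cdot> g')"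
    using f(1-4) g(1-4) assms(3) by (simp_all add: comp_assoc)
  then show ?thesis using f g assms(3) Dom_Obj Cod_Obj by (intro is_isoI[of _ "f' \<cdot> g'"]) auto
qed

text \<open>The inverse of \<open>q\<close> is the mediating morphism induced by
  \<open>g \<cdot> f'\<close> and the identity, where \<open>f'\<close> inverts
  \<open>f\<close>.\<close>

lemma pushout_iso:
  assumes P: "pushout C f g p q" and f: "is_iso C f"
  shows "is_iso C q"
proof -
  have P': "square C f g p q" using P by (rule pushout_square)
  from f obtain f' where f': "f \<in> Arr C" "f' \<in> Arr C" "Dom C f' = Cod C f"
    "Cod C f' = Dom C f" "f' \<cdot> f = Id C (Dom C f)" "f \<cdot> f' = Id C (Cod C f)" by (rule is_isoE)
  have "square C f g (g \<cdot> f') (Id C (Cod C g))"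
    using f' P' Cod_Obj[of g] by (simp add: square_iff comp_assoc)
  from pushout_ex[OF P this] obtain h where h: "h \<in> Arr C" "Dom C h = Cod C p"
    "Cod C h = Cod C g" "h \<cdot> p = g \<cdot> f'" "h \<cdot> q = Id C (Cod C g)"
    using f' P' by (auto simp: square_iff)
  have "(q \<cdot> h) \<cdot> p = (q \<cdot> g) \<cdot> f'" using h f' P' by (simp add: square_iff comp_assoc)
  also have "\<dots> = p \<cdot> (f \<cdot> f')"
    using f'(2-4) P' square_comp[OF P', of f'] by (simp add: square_iff comp_assoc)
  also have "\<dots> = p" using f' P' by (simp add: square_iff)
  finally have "q \<cdot> h = Id C (Cod C p)"
    using pushout_eq[OF P, of "q \<cdot> h" "Id C (Cod C p)"] h P' Cod_Obj
    by (auto simp: square_iff comp_assoc)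
  then show ?thesis using h P' by (intro is_isoI[of _ h]) (auto simp: square_iff)
qed

lemma pullback_iso_unique:
  assumes P: "pullback C f g p q" and P1: "pullback C f' g' p q"
  shows "span_iso C (f, g) (f', g')"
proof -
  have s: "square C f g p q" "square C f' g' p q" using P P1 by (auto dest: pullback_square)
  from pullback_ex[OF P s(2)] obtain e' where e': "e' \<in> Arr C" "Dom C e' = Dom C f'"
    "Cod C e' = Dom C f" "f \<cdot> e' = f'" "g \<cdot> e' = g'" by blast
  from pullback_ex[OF P1 s(1)] obtain e where e: "e \<in> Arr C" "Dom C e = Dom C f"
    "Cod C e = Dom C f'" "f' \<cdot> e = f" "g' \<cdot> e = g" by blast
  have "e' \<cdot> e = Id C (Dom C f)"
    using pullback_eq[OF P, of "e' \<cdot> e" "Id C (Dom C f)"] e e' s Dom_Obj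
    by (auto simp: square_iff comp_assoc[symmetric])
  moreover have "e \<cdot> e' = Id C (Dom C f')"
    using pullback_eq[OF P1, of "e \<cdot> e'" "Id C (Dom C f')"] e e' s Dom_Obj
    by (auto simp: square_iff comp_assoc[symmetric])
  ultimately have "is_iso C e" using e e' by (intro is_isoI[of _ e']) auto
  with e show ?thesis by (auto simp: span_iso_def hom_def)
qed

text \<open>Allows an overlap of two morphisms to be exchanged for the chosen representative of its
  isomorphism class. Cones are moved along \<open>e\<close> and its inverse
  \<open>i\<close>.\<close>

lemma pullback_span_iso:
  assumes P: "pullback C f g p q" and s: "span_iso C (f, g) (f', g')"
    and s': "f' \<in> Arr C" "g' \<in> Arr C" "Dom C f' = Dom C g'"
  shows "pullback C f' g' p q"
proof -
  have sq: "square C f g p q" using P by (rule pullback_square)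
  obtain e where e: "is_iso C e" "Dom C e = Dom C f" "Cod C e = Dom C f'" "f' \<cdot> e = f" "g' \<cdot> e = g"
    using s by (auto simp: span_iso_def hom_def)
  from e(1) obtain i where i: "e \<in> Arr C" "i \<in> Arr C" "Dom C i = Cod C e" "Cod C i = Dom C e"
    "i \<cdot> e = Id C (Dom C e)" "e \<cdot> i = Id C (Cod C e)" by (rule is_isoE)
  have "f \<cdot> i = f' \<cdot> (e \<cdot> i)" "g \<cdot> i = g' \<cdot> (e \<cdot> i)" using e i(1-4) s' by (auto simp: comp_assoc[symmetric])
  then have fi: "f \<cdot> i = f'" "g \<cdot> i = g'" using i e s' by auto
  show ?thesis
  proof (rule pullbackI)
    have "p \<cdot> f' = q \<cdot> g'"
      using square_comp[OF sq, of i] i e(2,3) by (simp add: fi)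
    moreover have "Cod C f' = Cod C f" "Cod C g' = Cod C g" using e i s' by (metis comp_simps(3))+
    ultimately show "square C f' g' p q" using sq s' by (simp add: square_iff)
  next
    fix a b assume S: "square C a b p q"
    from pullback_ex[OF P S] obtain h where h: "h \<in> Arr C" "Dom C h = Dom C a" "Cod C h = Dom C f"
      "f \<cdot> h = a" "g \<cdot> h = b" by blast
    have "f' \<cdot> (e \<cdot> h) = a" "g' \<cdot> (e \<cdot> h) = b" using h e i s' by (simp_all add: comp_assoc[symmetric])
    then show "\<exists>h\<in>Arr C. Dom C h = Dom C a \<and> Cod C h = Dom C f' \<and> f' \<cdot> h = a \<and> g' \<cdot> h = b"
      using h e i by (intro bexI[of _ "e \<cdot> h"]) auto
  next
    fix h h' assume H: "h \<in> Arr C" "h' \<in> Arr C" "Cod C h = Dom C f'" "Cod C h' = Dom C f'"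
      "f' \<cdot> h = f' \<cdot> h'" "g' \<cdot> h = g' \<cdot> h'"
    have eq: "f \<cdot> (i \<cdot> t) = f' \<cdot> t" "g \<cdot> (i \<cdot> t) = g' \<cdot> t" if "t \<in> Arr C" "Cod C t = Dom C f'" for t
      using that i e fi sq by (simp_all add: comp_assoc[symmetric] square_iff)
    have "i \<cdot> h = i \<cdot> h'" using pullback_eq[OF P, of "i \<cdot> h" "i \<cdot> h'"] H i e eq by simp
    then have "(e \<cdot> i) \<cdot> h = (e \<cdot> i) \<cdot> h'" using H(1-4) i(1-4) e(2,3) by (simp add: comp_assoc)
    then show "h = h'" using H(1-4) i(6) e(3) by simp
  qed
qed

section \<open>Monomorphisms, and pushouts along identities and isomorphisms\<close>

lemma monic_Arr: "monic C f \<Longrightarrow> f \<in> Arr C"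
  by (simp add: monic_def)

lemma monic_eq:
  assumes "monic C f" "g \<in> Arr C" "h \<in> Arr C" "Cod C g = Dom C f" "Cod C h = Dom C f"
    "f \<cdot> g = f \<cdot> h"
  shows "g = h"
proof -
  have "Dom C g = Dom C (f \<cdot> g)" "Dom C h = Dom C (f \<cdot> h)"
    using assms(1-5) by (auto simp: monic_def)
  then have "Dom C h = Dom C g" using assms by simp
  then show ?thesis using assms unfolding monic_def hom_def by blast
qed

text \<open>Cancelling \<open>w\<close> shows that the second leg of a cone determines the first.
  Squares of this shape are used as side faces of van Kampen cubes.\<close>

lemma pullback_monic:
  assumes "monic C w" "u \<in> Arr C" "Cod C u = Dom C w"
  shows "pullback C u (Id C (Dom C u)) w (w \<cdot> u)"
proof -
  have w: "w \<in> Arr C" using assms(1) by (rule monic_Arr)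
  show ?thesis
  proof (rule pullbackI)
    show "square C u (Id C (Dom C u)) w (w \<cdot> u)"
      using assms(2,3) w Dom_Obj by (simp add: square_iff)
    fix f' g' assume S: "square C f' g' w (w \<cdot> u)"
    have g': "Dom C g' = Dom C f'" "Cod C g' = Dom C u" "g' \<in> Arr C"
      using S assms(2,3) w by (auto simp: square_iff)
    have "w \<cdot> f' = w \<cdot> (u \<cdot> g')" using S g' assms(2,3) w by (simp add: square_iff comp_assoc)
    then have "f' = u \<cdot> g'" using monic_eq[OF assms(1), of f' "u \<cdot> g'"] S g' assms(2,3) w
      by (simp add: square_iff)
    then show "\<exists>h\<in>Arr C. Dom C h = Dom C f' \<and> Cod C h = Dom C u \<and> u \<cdot> h = f' \<and> Id C (Dom C u) \<cdot> h = g'"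
      using g' by (intro bexI[of _ g']) simp_all
  next
    fix h h' assume "h \<in> Arr C" "h' \<in> Arr C" "Cod C h = Dom C u" "Cod C h' = Dom C u"
      "Id C (Dom C u) \<cdot> h = Id C (Dom C u) \<cdot> h'"
    then show "h = h'" by simp
  qed
qed

text \<open>Because \<open>n\<close> can be cancelled, the extended cospan has the same cones as the
  original one.\<close>

lemma pullback_extend_monic:
  assumes P: "pullback C f g p q" and n: "monic C n" "Dom C n = Cod C p"
  shows "pullback C f g (n \<cdot> p) (n \<cdot> q)"
proof (rule pullbackI)
  have P': "square C f g p q" using P by (rule pullback_square)
  have na: "n \<in> Arr C" using n(1) by (rule monic_Arr)
  show "square C f g (n \<cdot> p) (n \<cdot> q)" using P' n(2) na by (simp add: square_iff comp_assoc)
  fix f' g' assume S: "square C f' g' (n \<cdot> p) (n \<cdot> q)"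
  then have "n \<cdot> (p \<cdot> f') = n \<cdot> (q \<cdot> g')" using P' n(2) na
    by (simp add: square_iff comp_assoc[symmetric])
  then have "p \<cdot> f' = q \<cdot> g'" using monic_eq[OF n(1), of "p \<cdot> f'" "q \<cdot> g'"] S P' n(2) na
    by (simp add: square_iff)
  then have "square C f' g' p q" using S P' n(2) na by (simp add: square_iff)
  from pullback_ex[OF P this]
  show "\<exists>h\<in>Arr C. Dom C h = Dom C f' \<and> Cod C h = Dom C f \<and> f \<cdot> h = f' \<and> g \<cdot> h = g'" .
qed (use pullback_eq[OF P] in auto)

lemma pushout_Id:
  assumes "g \<in> Arr C"
  shows "pushout C (Id C (Dom C g)) g g (Id C (Cod C g))"
proof (rule pushoutI)
  show "square C (Id C (Dom C g)) g g (Id C (Cod C g))"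
    using assms Dom_Obj Cod_Obj by (simp add: square_iff)
  fix p' q' assume "square C (Id C (Dom C g)) g p' q'"
  then show "\<exists>h\<in>Arr C. Dom C h = Cod C g \<and> Cod C h = Cod C p' \<and> h \<cdot> g = p' \<and> h \<cdot> Id C (Cod C g) = q'"
    using assms Dom_Obj Cod_Obj by (intro bexI[of _ q']) (auto simp: square_iff)
qed (use assms in auto)

lemma pushout_comp_iso:
  assumes P: "pushout C f g p q" and e: "is_iso C e" "Dom C e = Cod C p"
  shows "pushout C f g (e \<cdot> p) (e \<cdot> q)"
proof -
  have P': "square C f g p q" using P by (rule pushout_square)
  from e(1) obtain i where i: "e \<in> Arr C" "i \<in> Arr C" "Dom C i = Cod C e" "Cod C i = Dom C e"
    "i \<cdot> e = Id C (Dom C e)" "e \<cdot> i = Id C (Cod C e)" by (rule is_isoE)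
  show ?thesis
  proof (rule pushoutI)
    show "square C f g (e \<cdot> p) (e \<cdot> q)" using P' i e by (simp add: square_iff comp_assoc)
    fix p' q' assume S: "square C f g p' q'"
    from pushout_ex[OF P S] obtain h where h: "h \<in> Arr C" "Dom C h = Cod C p"
      "Cod C h = Cod C p'" "h \<cdot> p = p'" "h \<cdot> q = q'" by blast
    have "(h \<cdot> i) \<cdot> (e \<cdot> t) = h \<cdot> ((i \<cdot> e) \<cdot> t)" if "t \<in> Arr C" "Cod C t = Cod C p" for t
      using h i(1-4) e that by (simp add: comp_assoc)
    then have "(h \<cdot> i) \<cdot> (e \<cdot> p) = p'" "(h \<cdot> i) \<cdot> (e \<cdot> q) = q'"
      using h i e P' by (simp_all add: square_iff)
    then show "\<exists>h\<in>Arr C. Dom C h = Cod C (e \<cdot> p) \<and> Cod C h = Cod C p' \<and> h \<cdot> (e \<cdot> p) = p' \<and> h \<cdot> (e \<cdot> q) = q'"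
      using h i e P' by (intro bexI[of _ "h \<cdot> i"]) (auto simp: square_iff)
  next
    fix h h' assume H: "h \<in> Arr C" "h' \<in> Arr C" "Dom C h = Cod C (e \<cdot> p)" "Dom C h' = Cod C (e \<cdot> p)"
      "h \<cdot> (e \<cdot> p) = h' \<cdot> (e \<cdot> p)" "h \<cdot> (e \<cdot> q) = h' \<cdot> (e \<cdot> q)"
    have d: "Dom C h = Cod C e" "Dom C h' = Cod C e" using H P' i e by (auto simp: square_iff)
    have "(t \<cdot> e) \<cdot> p = t \<cdot> (e \<cdot> p)" "(t \<cdot> e) \<cdot> q = t \<cdot> (e \<cdot> q)"
      if "t \<in> Arr C" "Dom C t = Cod C e" for t
      using that P' i(1) e(2) by (simp_all add: square_iff comp_assoc)
    then have "h \<cdot> e = h' \<cdot> e"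
      using pushout_eq[OF P, of "h \<cdot> e" "h' \<cdot> e"] H(1,2,5,6) d i(1) e(2) by simp
    then have "(h \<cdot> e) \<cdot> i = (h' \<cdot> e) \<cdot> i" by simp
    then have "h \<cdot> (e \<cdot> i) = h' \<cdot> (e \<cdot> i)" using H(1,2) d i(1-4) by (simp add: comp_assoc)
    then show "h = h'" using H(1,2) d i(6) by simp
  qed
qed

end

section \<open>Pushouts along \<open>\<M>\<close>-morphisms\<close>

context M_adhesive
begin

lemma M_Arr: "f \<in> M \<Longrightarrow> f \<in> Arr C"
  by (rule monic_Arr[OF M_monic])

lemma Id_M: "A \<in> Obj C \<Longrightarrow> Id C A \<in> M"
  by (rule M_iso[OF is_iso_Id])

lemma pullback_M:
  assumes "w \<in> M" "u \<in> Arr C" "Cod C u = Dom C w"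
  shows "pullback C u (Id C (Dom C u)) w (w \<cdot> u)"
  using pullback_monic[OF M_monic] assms by blast

lemma pullback_Id:
  assumes "u \<in> Arr C"
  shows "pullback C u (Id C (Dom C u)) (Id C (Cod C u)) u"
  using pullback_M[OF Id_M, of "Cod C u" u] assms Cod_Obj by simp

text \<open>
  The van Kampen cube whose top face is the pushout of an identity along \<open>g\<close> has the given square
  as a vertical face.
\<close>

lemma pushout_M_pullback:
  assumes P: "pushout C f g p q" and f: "f \<in> M"
  shows "pullback C f g p q"
proof -
  have P': "square C f g p q" using P by (rule pushout_square)
  then have arr: "f \<in> Arr C" "g \<in> Arr C" "p \<in> Arr C" "q \<in> Arr C" "Dom C g = Dom C f"
    "Cod C f = Dom C p" "Cod C g = Dom C q" "p \<cdot> f = q \<cdot> g" "Cod C q = Cod C p"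
    by (auto simp: square_iff)
  let ?A = "Id C (Dom C f)" and ?B = "Id C (Dom C q)"
  have q: "q \<in> M" using P f by (rule M_pushout)
  have Ob: "Dom C f \<in> Obj C" "Dom C q \<in> Obj C" using arr Dom_Obj by auto
  have top: "pushout C ?A g g ?B" using pushout_Id[OF arr(2)] arr by simp
  have "pullback C ?A ?A f f" using pullback_M[OF f, of ?A] arr Ob by simp
  moreover have "pullback C g ?A ?B g" using pullback_Id[OF arr(2)] arr by simp
  moreover have "square C ?B ?B q q" using arr Ob by (simp add: square_iff)
  moreover have "square C g f q p" using P' by (rule square_sym)
  moreover have "?A \<in> M" "?B \<in> M" using Ob Id_M by auto
  ultimately have "pullback C g f q p"
    using M_vK[OF P f] top pushout_square[OF top] f q unfolding M_van_kampen_def by blast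
  then show ?thesis by (rule pullback_sym)
qed

text \<open>In the cube over the outer pushout \<open>W\<close> with the square
  \<open>f k m h\<close> on top, the vertical morphisms are two identities, \<open>l\<close> and
  \<open>n\<close>. All four side faces are pullbacks, so the van Kampen property makes the top a
  pushout.\<close>

lemma pushout_pullback_decomp:
  assumes W: "pushout C f (l \<cdot> k) (n \<cdot> m) j" and Q: "pullback C h l n j"
    and S: "square C f k m h" and f: "f \<in> M" and n: "n \<in> M"
  shows "pushout C f k m h"
proof -
  have Q': "square C h l n j" using Q by (rule pullback_square)
  have arr: "f \<in> Arr C" "k \<in> Arr C" "m \<in> Arr C" "l \<in> Arr C" "Dom C k = Dom C f"
    "Cod C f = Dom C m" "Cod C k = Dom C l" "Cod C m = Dom C n"
    using S Q' by (auto simp: square_iff)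
  let ?A = "Id C (Dom C f)" and ?B = "Id C (Dom C m)"
  have l: "l \<in> M" using M_pullback[OF Q n] .
  have "pullback C m ?B n (n \<cdot> m)" using pullback_M[OF n] arr by simp
  moreover have "pullback C f ?A ?B f" using pullback_Id arr by force
  moreover have "pullback C k ?A l (l \<cdot> k)" using pullback_M[OF l, of k] arr by simp
  moreover have "?A \<in> M" "?B \<in> M" using arr Dom_Obj Id_M by auto
  ultimately show ?thesis
    using M_vK[OF W f] l n S Q pullback_square unfolding M_van_kampen_def by blast
qed

text \<open>
  Two pushout complements are compared through the pullback of \<open>h'\<close> and \<open>h\<close>: in the cube over the first
  pushout with this pullback as a face, the top face is a pushout of an identity.
\<close>

lemma pushout_complement_pullback_iso:
  assumes P: "pushout C i k m h" and P1: "pushout C i k' m h'" and i: "i \<in> M"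
    and E: "pullback C q c h' h" and t: "t \<in> Arr C" "Cod C t = Dom C c" "c \<cdot> t = k" "q \<cdot> t = k'"
  shows "is_iso C q"
proof -
  have sq: "square C i k m h" "square C i k' m h'" "square C q c h' h"
    using P P1 E by (auto dest: pushout_square pullback_square)
  have h': "h' \<in> M" using M_pushout[OF P1 i] .
  have c: "c \<in> M" using M_pullback[OF E h'] .
  let ?A = "Id C (Dom C i)"
  have k': "k' \<in> Arr C" and cA: "c \<in> Arr C" and iA: "i \<in> Arr C" and di: "Dom C k = Dom C i"
    using sq by (auto simp: square_iff)
  have "Dom C t = Dom C k" using t cA by (metis comp_simps(2))
  then have dt: "Dom C t = Dom C i" using di by simp
  have Ob: "Dom C i \<in> Obj C" using iA Dom_Obj by auto
  have "pullback C ?A ?A i i" using pullback_M[OF i, of ?A] iA Ob by simp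
  moreover have "pullback C t ?A c k" using pullback_M[OF c, of t] t dt by simp
  moreover have "pullback C k' i h' m" using pushout_M_pullback[OF P1 i] by (rule pullback_sym)
  moreover have "square C ?A t k' q" using sq t dt Ob by (auto simp: square_iff)
  moreover have "?A \<in> M" using Ob by (rule Id_M)
  ultimately have "pushout C ?A t k' q"
    using M_vK[OF P i] c i h' E pullback_square unfolding M_van_kampen_def by blast
  then show ?thesis using is_iso_Id[OF Ob] by (rule pushout_iso)
qed

text \<open>By the preceding comparison, used in both directions, both projections \<open>q\<close>
  and \<open>c\<close> of the pullback of \<open>h'\<close> and \<open>h\<close> are isomorphisms.
  The required \<open>e\<close> is \<open>q\<close> after the inverse of \<open>c\<close>.\<close>

lemma pushout_complement_unique:
  assumes P: "pushout C i k m h" and P1: "pushout C i k' m h'" and i: "i \<in> M"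
  shows "\<exists>e. is_iso C e \<and> Dom C e = Cod C k \<and> Cod C e = Cod C k' \<and> e \<cdot> k = k' \<and> h' \<cdot> e = h"
proof -
  have sq: "square C i k m h" "square C i k' m h'"
    using P P1 by (auto dest: pushout_square)
  have h': "h' \<in> M" using M_pushout[OF P1 i] .
  obtain q c where E: "pullback C q c h' h"
    using M_pullback_exists[OF h', of h] sq by (auto simp: square_iff)
  have E': "square C q c h' h" using E by (rule pullback_square)
  have "square C k' k h' h" using sq by (auto simp: square_iff)
  from pullback_ex[OF E this] obtain t where
    t: "t \<in> Arr C" "Cod C t = Dom C q" "q \<cdot> t = k'" "c \<cdot> t = k" by blast
  have dqc: "Dom C q = Dom C c" using E' by (simp add: square_iff)
  have q: "is_iso C q"
    using pushout_complement_pullback_iso[OF P P1 i E] t dqc by simp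
  have c: "is_iso C c"
    using pushout_complement_pullback_iso[OF P1 P i pullback_sym[OF E]] t by simp
  from c obtain d where d: "is_iso C d" "c \<in> Arr C" "d \<in> Arr C" "Dom C d = Cod C c" "Cod C d = Dom C c"
    "d \<cdot> c = Id C (Dom C c)" "c \<cdot> d = Id C (Cod C c)" by (rule is_iso_inverse)
  have e: "is_iso C (q \<cdot> d)" using is_iso_comp[OF d(1) q] d(5) dqc by simp
  have qA: "q \<in> Arr C" "Cod C q = Dom C h'" "h' \<in> Arr C" "h \<in> Arr C" "Cod C c = Dom C h"
    using E' by (auto simp: square_iff)
  have "(q \<cdot> d) \<cdot> (c \<cdot> t) = q \<cdot> ((d \<cdot> c) \<cdot> t)"
    using d(2-5) qA t(1,2) dqc by (simp add: comp_assoc)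
  then have 1: "(q \<cdot> d) \<cdot> k = k'" using d(6) t dqc by simp
  have "h' \<cdot> (q \<cdot> d) = h \<cdot> (c \<cdot> d)" using square_comp[OF E' d(3)] d(5) dqc by simp
  then have 2: "h' \<cdot> (q \<cdot> d) = h" using d(7) qA by simp
  show ?thesis using e 1 2 d qA dqc sq by (intro exI[of _ "q \<cdot> d"]) (auto simp: square_iff)
qed

text \<open>The third part reads the pushout along \<open>f\<close> as a pullback, so that
  membership in \<open>M\<close> passes back from \<open>p\<close> to \<open>g\<close>.\<close>

lemma pushout_leg_M:
  assumes "pushout C f g p q"
  shows "f \<in> M \<Longrightarrow> q \<in> M" "g \<in> M \<Longrightarrow> p \<in> M"
    "f \<in> M \<Longrightarrow> p \<in> M \<Longrightarrow> g \<in> M"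
  using M_pushout[OF assms] M_pushout[OF pushout_sym[OF assms]]
    M_pullback[OF pushout_M_pullback[OF assms]] by auto

text \<open>Pulling \<open>h\<close> back along \<open>q\<close> cuts the square \<open>W\<close> in
  two, and the upper piece is a pushout by \<open>pushout_pullback_decomp\<close>. Any given
  complement of \<open>i\<close> and \<open>a\<close> is isomorphic to the one found this way, which
  yields \<open>l\<close> for it as well.\<close>

lemma restrict_complement:
  assumes W: "pushout C i K (q \<cdot> a) h" and i: "i \<in> M" and q: "q \<in> M"
    and a: "a \<in> Arr C" "Dom C a = Cod C i" "Cod C a = Dom C q"
  shows restrict_complement_exists: "\<exists>k o'. pushout C i k a o'"
    and restrict_complement_context:
      "pushout C i k a o' \<Longrightarrow> \<exists>l \<in> M. Dom C l = Cod C k \<and> l \<cdot> k = K \<and> pushout C o' l q h"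
proof -
  have W': "square C i K (q \<cdot> a) h" using W by (rule pushout_square)
  have qA: "q \<in> Arr C" using q by (rule M_Arr)
  have "h \<in> Arr C" "Cod C h = Cod C q" using W' a qA by (auto simp: square_iff)
  then obtain o1 l1 where E: "pullback C o1 l1 q h" using M_pullback_exists[OF q, of h] by auto
  have E': "square C o1 l1 q h" using E by (rule pullback_square)
  have l1: "l1 \<in> M" using M_pullback[OF E q] .
  have "square C (a \<cdot> i) K q h" using W' a qA by (simp add: square_iff comp_assoc[symmetric])
  from pullback_ex[OF E this] obtain k1 where
    k1: "k1 \<in> Arr C" "Dom C k1 = Dom C (a \<cdot> i)" "Cod C k1 = Dom C o1" "o1 \<cdot> k1 = a \<cdot> i" "l1 \<cdot> k1 = K"
    by blast
  have "square C i k1 a o1" using k1 E' W' a by (simp add: square_iff)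
  then have P1: "pushout C i k1 a o1"
    using pushout_pullback_decomp[of i l1 k1 q a h o1] W k1(5) E i q by simp
  then show "\<exists>k o'. pushout C i k a o'" by blast
  assume P: "pushout C i k a o'"
  have P': "square C i k a o'" using P by (rule pushout_square)
  from pushout_complement_unique[OF P P1 i] obtain e where
    e: "is_iso C e" "Dom C e = Cod C k" "Cod C e = Cod C k1" "e \<cdot> k = k1" "o1 \<cdot> e = o'" by blast
  have eM: "e \<in> M" using M_iso[OF e(1)] .
  have eA: "e \<in> Arr C" using M_Arr[OF eM] .
  let ?l = "l1 \<cdot> e"
  have l: "?l \<in> M" using M_comp[OF eM l1] e(3) k1(3) E' by (simp add: square_iff)
  have lA: "?l \<in> Arr C" "Dom C ?l = Cod C k"
    using eA e(2,3) k1(3) E' by (auto simp: square_iff)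
  have lk: "?l \<cdot> k = K" using eA e k1 E' P' by (simp add: square_iff comp_assoc)
  have W2: "pushout C i (?l \<cdot> k) (q \<cdot> a) h" using W lk by simp
  from pushout_decomp[OF P W2 lA] obtain n where n: "n \<cdot> a = q \<cdot> a" "pushout C o' ?l n h" by blast
  have n': "square C o' ?l n h" using n(2) by (rule pushout_square)
  \<comment> \<open>Decomposition yields the lower square only with some \<open>n\<close>; it equals
    \<open>q\<close> because both agree on the pushout legs \<open>a\<close> and
    \<open>o'\<close>.\<close>
  have "n \<cdot> o' = h \<cdot> ?l" using n' by (simp add: square_iff)
  also have "\<dots> = q \<cdot> (o1 \<cdot> e)" using square_comp[OF E' eA] e(3) k1(3) by simp
  finally have "n \<cdot> o' = q \<cdot> o'" using e(5) by simp
  moreover have "n \<in> Arr C" "Dom C n = Cod C a" "Dom C q = Cod C a"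
    using n' P' a(3) by (simp_all add: square_iff)
  ultimately have "n = q" using pushout_eq[OF P _ qA] n(1) by blast
  then show "\<exists>l \<in> M. Dom C l = Cod C k \<and> l \<cdot> k = K \<and> pushout C o' l q h"
    using l lk n(2) lA by blast
qed

text \<open>The two context objects are related by an isomorphism \<open>e\<close>. Cutting the
  second output pushout at \<open>ctxt d\<close> exhibits the comparison \<open>n\<close> of the
  results as a pushout of \<open>e\<close>.\<close>

lemma dpo_step_isomorphic:
  assumes "dpo_step C M r m X Y" "dpo_step C M r m X Y'" "linear_rule C M r"
  shows "isomorphic C Y Y'"
proof -
  have i: "ileg r \<in> M" using assms(3) by (simp add: linear_rule_def)
  obtain d :: "'a dpo" where d: "pushout C (ileg r) (ctxt d) m (in_emb d)" "pushout C (oleg r) (ctxt d) (comatch d) (out_emb d)"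
    "Cod C (comatch d) = Y"
    using assms(1) unfolding dpo_step_def dpo_diagram_def pushout_complement_def by blast
  obtain d' :: "'a dpo" where d': "pushout C (ileg r) (ctxt d') m (in_emb d')"
    "pushout C (oleg r) (ctxt d') (comatch d') (out_emb d')" "Cod C (comatch d') = Y'"
    using assms(2) unfolding dpo_step_def dpo_diagram_def pushout_complement_def by blast
  from pushout_complement_unique[OF d(1) d'(1) i] obtain e where
    e: "is_iso C e" "Dom C e = Cod C (ctxt d)" "e \<cdot> ctxt d = ctxt d'" by blast
  have eA: "e \<in> Arr C" using M_Arr[OF M_iso[OF e(1)]] .
  have "pushout C (oleg r) (e \<cdot> ctxt d) (comatch d') (out_emb d')" using d'(2) e(3) by simp
  from pushout_decomp[OF d(2) this eA e(2)] obtain n where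
    "pushout C (out_emb d) e n (out_emb d')" "n \<cdot> comatch d = comatch d'" by blast
  then have "is_iso C n" and sq: "square C (out_emb d) e n (out_emb d')"
    using pushout_iso[OF pushout_sym e(1)] pushout_square by blast+
  moreover have "Dom C n = Y" "Cod C n = Y'"
    using sq pushout_square[OF d(2)] pushout_square[OF d'(2)] d(3) d'(3) by (auto simp: square_iff)
  ultimately show ?thesis by (intro isomorphicI)
qed

end

section \<open>Semantics of \<open>Shift\<close> and \<open>Trans\<close>\<close>

lemma sat_CAnd [simp]: "sat C M (CAnd c d) p \<longleftrightarrow> sat C M c p \<and> sat C M d p"
  by (auto simp: CAnd_def)

section \<open>The cospans occurring in \<open>Shift\<close>\<close>

context M_adhesive begin

text \<open>Since \<open>cospan_iso\<close> is reflexive on these cospans, every class contains the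
  cospan generating it, and the choice of a representative lands in the class.\<close>

lemma shift_reps_cospans:
  "z \<in> shift_reps C M p a \<Longrightarrow> z \<in> shift_cospans C M p a"
  and shift_reps_iso:
  "z \<in> shift_cospans C M p a \<Longrightarrow> \<exists>z' \<in> shift_reps C M p a. cospan_iso C z z'"
proof -
  let ?S = "shift_cospans C M p a"
  let ?R = "{(z, z'). z \<in> ?S \<and> z' \<in> ?S \<and> cospan_iso C z z'}"
  have refl: "(z, z) \<in> ?R" if z: "z \<in> ?S" for z
  proof -
    obtain r s where rs: "z = (r, s)" by (cases z)
    then obtain p' a' where "pushout C p' a' r s" using z by (auto simp: shift_cospans_def)
    then have "r \<in> Arr C" "s \<in> Arr C" "Cod C s = Cod C r"
      by (auto dest!: pushout_square simp: square_iff)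
    then have "cospan_iso C z z"
      using rs is_iso_Id[of "Cod C r"] Cod_Obj unfolding cospan_iso_def
      by (simp add: hom_def) (intro exI[of _ "Id C (Cod C r)"], simp)
    then show ?thesis using z by simp
  qed
  have rep: "(z, SOME z'. z' \<in> ?R `` {z}) \<in> ?R" if "z \<in> ?S" for z
    using someI[of "\<lambda>z'. z' \<in> ?R `` {z}" z] refl[OF that] by blast
  {
    assume "z \<in> shift_reps C M p a"
    then obtain y where "y \<in> ?S" "z = (SOME z'. z' \<in> ?R `` {y})"
      unfolding shift_reps_def by (auto elim!: quotientE)
    with rep[of y] show "z \<in> ?S" by simp
  }
  assume z: "z \<in> ?S"
  have "(SOME z'. z' \<in> ?R `` {z}) \<in> shift_reps C M p a"
    unfolding shift_reps_def by (rule imageI) (rule quotientI[OF z])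
  then show "\<exists>z' \<in> shift_reps C M p a. cospan_iso C z z'"
    using rep[OF z] by blast
qed

text \<open>Composing the pushout square of \<open>p'\<close> and \<open>a'\<close> with
  \<open>x\<close> gives the commutation with \<open>p\<close> and \<open>a\<close>.\<close>

lemma shift_cospanE:
  assumes "(r, s) \<in> shift_cospans C M p a" and p: "p \<in> M" and a: "a \<in> M"
  obtains "r \<in> M" "s \<in> M" "Dom C r = Cod C p" "Dom C s = Cod C a" "Cod C s = Cod C r"
    "r \<cdot> p = s \<cdot> a"
proof -
  obtain p' a' x where H: "p' \<in> M" "a' \<in> M" "x \<in> M" "pushout C p' a' r s"
    "Dom C x = Dom C p" "Cod C x = Dom C p'" "Cod C p' = Cod C p" "Cod C a' = Cod C a"
    "p' \<cdot> x = p" "a' \<cdot> x = a"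
    using assms(1) by (auto simp: shift_cospans_def hom_def)
  have sq: "square C p' a' r s" using H(4) by (rule pushout_square)
  have "r \<in> M" "s \<in> M" using pushout_leg_M[OF H(4)] H by auto
  moreover have "r \<cdot> p = s \<cdot> a"
    using square_comp[OF sq M_Arr[OF H(3)]] H by simp
  ultimately show thesis using that sq H by (simp add: square_iff)
qed

text \<open>Provides the typing hypothesis needed when \<open>sat_Trans\<close> is applied to the
  shifted condition of the second rule.\<close>

lemma cond_over_Shift:
  "cond_over C M c (Dom C p) \<Longrightarrow> p \<in> M \<Longrightarrow> cond_over C M (Shift C M c p) (Cod C p)"
proof (induction c arbitrary: p)
  case CTrue
  then show ?case using M_Arr Cod_Obj by auto
next
  case (CEx a c)
  have Ob: "Cod C p \<in> Obj C" using CEx.prems M_Arr Cod_Obj by auto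
  have "cond_over C M (CEx r (Shift C M c s)) (Cod C p)" if "(r, s) \<in> shift_reps C M p a" for r s
  proof -
    have "r \<in> M" "s \<in> M" "Dom C r = Cod C p" "Dom C s = Cod C a" "Cod C s = Cod C r"
      using shift_cospanE[OF shift_reps_cospans[OF that]] CEx.prems by auto
    then show ?thesis using CEx.IH[of s] CEx.prems by simp
  qed
  then show ?case using Ob by auto
next
  case (CNot c)
  then show ?case by simp
next
  case (CConj J c)
  then show ?case using M_Arr Cod_Obj by auto
qed

end

context dpo_setting begin

text \<open>
  For \<open>\<exists>(a, c)\<close> the representative cospan is found by pulling back the morphism witnessing \<open>a\<close>
  along \<open>n\<close>; effective unions make the induced morphism out of the pushout an \<open>\<M>\<close>-morphism.
\<close>

lemma sat_Shift:
  assumes "cond_over C M c (Dom C p)" "p \<in> M" "n \<in> M" "Dom C n = Cod C p"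
  shows "sat C M (Shift C M c p) n \<longleftrightarrow> sat C M c (n \<cdot> p)"
  using assms
proof (induction c arbitrary: p n)
  case CTrue
  then show ?case by simp
next
  case (CEx a c)
  have a: "a \<in> M" "Dom C a = Dom C p" and c: "cond_over C M c (Cod C a)"
    using CEx.prems by auto
  have pA: "p \<in> Arr C" "n \<in> Arr C" "a \<in> Arr C" using CEx.prems a M_Arr by auto
  have shift: "sat C M (Shift C M (CEx a c) p) n \<longleftrightarrow>
    (\<exists>(r, s) \<in> shift_reps C M p a. sat C M (CEx r (Shift C M c s)) n)"
    by (simp add: case_prod_beta conj_ac)
  show ?case
  proof
    assume "sat C M (Shift C M (CEx a c) p) n"
    then obtain r s q where rs: "(r, s) \<in> shift_reps C M p a"
      and q: "q \<in> M" "q \<in> hom C (Cod C r) (Cod C n)" "q \<cdot> r = n" "sat C M (Shift C M c s) q"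
      unfolding shift by auto
    have L: "r \<in> M" "s \<in> M" "Dom C r = Cod C p" "Dom C s = Cod C a" "Cod C s = Cod C r"
      "r \<cdot> p = s \<cdot> a"
      using shift_cospanE[OF shift_reps_cospans[OF rs] CEx.prems(2) a(1)] by auto
    have A: "r \<in> Arr C" "s \<in> Arr C" "q \<in> Arr C" "Dom C q = Cod C r" "Cod C q = Cod C n"
      using L q M_Arr by (auto simp: hom_def)
    have "q \<cdot> s \<in> M" using M_comp L q A by simp
    moreover have "q \<cdot> s \<in> hom C (Cod C a) (Cod C (n \<cdot> p))"
      using A L pA CEx.prems(4) by (simp add: hom_def)
    moreover have "(q \<cdot> s) \<cdot> a = q \<cdot> (r \<cdot> p)" using A L pA by (simp add: comp_assoc)
    moreover have "\<dots> = (q \<cdot> r) \<cdot> p" using A L pA by (simp add: comp_assoc)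
    moreover have "sat C M c (q \<cdot> s)" using CEx.IH[of s q] c L q A by simp
    ultimately show "sat C M (CEx a c) (n \<cdot> p)" using q(3) by auto
  next
    assume "sat C M (CEx a c) (n \<cdot> p)"
    then obtain t where t: "t \<in> M" "t \<in> hom C (Cod C a) (Cod C (n \<cdot> p))" "t \<cdot> a = n \<cdot> p" "sat C M c t"
      by auto
    have tA: "t \<in> Arr C" "Dom C t = Cod C a" "Cod C t = Cod C n"
      using t(2) pA CEx.prems(4) by (auto simp: hom_def)
    obtain p' a' where E: "pullback C p' a' n t"
      using M_pullback_exists[of n t] CEx.prems tA by auto
    have E': "square C p' a' n t" using E by (rule pullback_square)
    have p'a': "p' \<in> M" "a' \<in> M"
      using M_pullback[OF E CEx.prems(3)] M_pullback[OF pullback_sym[OF E] t(1)] by auto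
    have "square C p a n t" using pA tA t(3) CEx.prems(4) a(2) by (simp add: square_iff)
    from pullback_ex[OF E this] obtain x where
      x: "x \<in> Arr C" "Dom C x = Dom C p" "Cod C x = Dom C p'" "p' \<cdot> x = p" "a' \<cdot> x = a" by blast
    \<comment> \<open>Decomposition of \<open>p = p' \<cdot> x\<close> puts \<open>x\<close> in
      \<open>M\<close>; this is the witness that admits the cospan \<open>(r, s)\<close> to the
      disjunction.\<close>
    have "x \<in> M" using M_decomp[of x p'] x p'a' CEx.prems(2) by simp
    obtain r s where P: "pushout C p' a' r s"
      using M_pushout_exists[of p' a'] p'a' E' by (auto simp: square_iff)
    from pushout_ex[OF P E'] obtain h where h: "h \<in> Arr C" "Dom C h = Cod C r"
      "Cod C h = Cod C n" "h \<cdot> r = n" "h \<cdot> s = t" by blast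
    have hM: "h \<in> M"
      using M_effective_unions[OF p'a' P CEx.prems(3) t(1) E homI[OF h(1-3)] h(4,5)] .
    have "(r, s) \<in> shift_cospans C M p a"
    proof -
      have "x \<in> hom C (Dom C p) (Dom C p')" "Cod C p' = Cod C p" "Cod C a' = Cod C a"
        using x(1-3) E' CEx.prems(4) tA by (auto simp: hom_def square_iff)
      then show ?thesis
        unfolding shift_cospans_def using p'a' \<open>x \<in> M\<close> P x(4,5) by blast
    qed
    then obtain r' s' where rs': "(r', s') \<in> shift_reps C M p a" "cospan_iso C (r, s) (r', s')"
      using shift_reps_iso by (metis surj_pair)
    have L: "r' \<in> M" "s' \<in> M" "Dom C r' = Cod C p" "Dom C s' = Cod C a" "Cod C s' = Cod C r'"
      using shift_cospanE[OF shift_reps_cospans[OF rs'(1)] CEx.prems(2) a(1)] by auto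
    obtain e where e: "is_iso C e" "Dom C e = Cod C r" "Cod C e = Cod C r'" "e \<cdot> r = r'" "e \<cdot> s = s'"
      using rs'(2) by (auto simp: cospan_iso_def hom_def)
    from e(1) obtain d where d: "is_iso C d" "e \<in> Arr C" "d \<in> Arr C" "Dom C d = Cod C e" "Cod C d = Dom C e"
      "d \<cdot> e = Id C (Dom C e)" "e \<cdot> d = Id C (Cod C e)" by (rule is_iso_inverse)
    \<comment> \<open>The chosen representative differs from \<open>(r, s)\<close> by the
      isomorphism \<open>e\<close>, so \<open>h\<close> is precomposed with the inverse of
      \<open>e\<close>.\<close>
    let ?q = "h \<cdot> d"
    have q: "?q \<in> M" using M_comp[OF M_iso[OF d(1)] hM] d e h by simp
    have PA: "square C p' a' r s" using P by (rule pushout_square)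
    have "?q \<cdot> (e \<cdot> u) = h \<cdot> ((d \<cdot> e) \<cdot> u)" if "u \<in> Arr C" "Cod C u = Cod C r" for u
      using that d(2-5) e(2,3) h(1,2) by (simp add: comp_assoc)
    then have "?q \<cdot> (e \<cdot> r) = h \<cdot> r" "?q \<cdot> (e \<cdot> s) = h \<cdot> s"
      using PA d(6) e(2) by (simp_all add: square_iff)
    then have qr: "?q \<cdot> r' = n" "?q \<cdot> s' = t" unfolding e(4,5) h(4,5) .
    have qd: "Dom C ?q = Cod C r'" "Cod C ?q = Cod C n" "?q \<in> Arr C"
      using d(2-5) e(2,3) h(1-3) by simp_all
    have "sat C M (Shift C M c s') ?q" using CEx.IH[of s' ?q] c L q qd qr t(4) by simp
    then have "sat C M (CEx r' (Shift C M c s')) n" using q qr qd by (auto simp: hom_def)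
    then show "sat C M (Shift C M (CEx a c) p) n" unfolding shift using rs'(1) by blast
  qed
next
  case (CNot c)
  then show ?case by simp
next
  case (CConj J c)
  then show ?case by simp
qed

end

section \<open>Satisfaction of transported conditions\<close>

context M_adhesive begin

text \<open>For \<open>CEx\<close>, factoring the match through \<open>aa\<close> and factoring the
  comatch through \<open>a\<close> both amount to factoring \<open>k\<close> through
  \<open>ks\<close> by a morphism \<open>l\<close>: restricting a complement yields
  \<open>l\<close>, and cutting the opposite pushout at \<open>ks\<close> yields the other
  factorization. The lower double pushout is then an application of the transported rule, to which
  the induction hypothesis applies.\<close>

lemma sat_Trans:
  assumes "cond_over C M c (Cod C (oleg r))" "linear_rule C M r" "m \<in> M"
    "pushout C (ileg r) k m h" "pushout C (oleg r) k m' h'"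
  shows "sat C M (Trans C c r) m \<longleftrightarrow> sat C M c m'"
  using assms
proof (induction c arbitrary: r m k h m' h')
  case CTrue
  then show ?case by simp
next
  case (CEx a c)
  note P = CEx.prems(4) and P' = CEx.prems(5)
  have a: "a \<in> M" "Dom C a = Cod C (oleg r)" and c: "cond_over C M c (Cod C a)"
    using CEx.prems by auto
  have legs: "ileg r \<in> M" "oleg r \<in> M" "Dom C (oleg r) = Dom C (ileg r)"
    using CEx.prems by (auto simp: linear_rule_def)
  have sq: "square C (ileg r) k m h" "square C (oleg r) k m' h'"
    using P P' by (auto dest: pushout_square)
  have aA: "a \<in> Arr C" using a M_Arr by auto
  show ?case
  proof (cases "\<exists>k o'. pushout C (oleg r) k a o'")
    case False
    \<comment> \<open>If the comatch factored as \<open>q \<cdot> a\<close>, its complement would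
      restrict along \<open>q\<close> to a complement of \<open>a\<close>, which does not exist
      here.\<close>
    have "\<not> sat C M (CEx a c) m'"
    proof
      assume "sat C M (CEx a c) m'"
      then obtain q where q: "q \<in> M" "q \<in> hom C (Cod C a) (Cod C m')" "q \<cdot> a = m'" by auto
      show False
        using restrict_complement_exists[of "oleg r" k q a h'] False P' legs q a aA
        by (auto simp: hom_def)
    qed
    then show ?thesis using False by (simp add: pushout_complement_def)
  next
    case True
    let ?ch = "\<lambda>(k, o', a', i'). pushout C (oleg r) k a o' \<and> pushout C (ileg r) k a' i'"
    obtain ks os aa ii where ch: "(SOME t. ?ch t) = (ks, os, aa, ii)"
      by (rule prod_cases4)
    \<comment> \<open>Some tuple meets the specification inside \<open>Trans\<close>: a complement
      exists, and the pushout on the input side can be formed from it. Hence the chosen tuple meets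
      it too.\<close>
    obtain k1 o1 where P1: "pushout C (oleg r) k1 a o1" using True by blast
    then have "k1 \<in> Arr C" "Dom C k1 = Dom C (ileg r)"
      using legs(3) by (auto dest!: pushout_square simp: square_iff)
    then obtain a1 i1 where P2: "pushout C (ileg r) k1 a1 i1"
      using M_pushout_exists[OF legs(1), of k1] by auto
    have "?ch (k1, o1, a1, i1)" using P1 P2 by simp
    then have "?ch (SOME t. ?ch t)" by (rule someI[of ?ch])
    then have Q: "pushout C (oleg r) ks a os" and Q': "pushout C (ileg r) ks aa ii"
      unfolding ch by auto
    have trans: "Trans C (CEx a c) r = CEx aa (Trans C c (Rule os ii))"
      using True ch by (simp add: pushout_complement_def)
    have sq': "square C (oleg r) ks a os" "square C (ileg r) ks aa ii"
      using Q Q' by (auto dest: pushout_square)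
    have ks: "ks \<in> M" using pushout_leg_M(3)[OF Q legs(2) a(1)] .
    then have QM: "os \<in> M" "ii \<in> M" "ks \<in> M" "aa \<in> M"
      using pushout_leg_M(1)[OF Q legs(2)] pushout_leg_M(1)[OF Q' legs(1)]
        pushout_leg_M(2)[OF Q' ks] by simp_all
    have lin: "linear_rule C M (Rule os ii)"
      using QM sq' by (simp add: linear_rule_def square_iff)
    have cod: "Cod C os = Cod C a" using sq' by (simp add: square_iff)
    have IH: "sat C M (Trans C c (Rule os ii)) q \<longleftrightarrow> sat C M c q'"
      if "q \<in> M" "pushout C ii l q h" "pushout C os l q' h'" for q q' l
      using CEx.IH[of "Rule os ii" q l h q' h'] that c lin cod by simp
    show ?thesis unfolding trans
    proof
      assume "sat C M (CEx aa (Trans C c (Rule os ii))) m"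
      then obtain q where q: "q \<in> M" "q \<in> hom C (Cod C aa) (Cod C m)" "q \<cdot> aa = m"
        "sat C M (Trans C c (Rule os ii)) q" by auto
      have "\<exists>l \<in> M. Dom C l = Cod C ks \<and> l \<cdot> ks = k \<and> pushout C ii l q h"
        using restrict_complement_context[of "ileg r" k q aa h ks ii] P legs q QM M_Arr sq' Q'
        by (auto simp: hom_def square_iff)
      then obtain l where l: "l \<in> M" "Dom C l = Cod C ks" "l \<cdot> ks = k" "pushout C ii l q h"
        by blast
      have "pushout C (oleg r) (l \<cdot> ks) m' h'" using P' l(3) by simp
      from pushout_decomp[OF Q this M_Arr[OF l(1)] l(2)] obtain n where
        n: "n \<cdot> a = m'" "pushout C os l n h'" by blast
      have "n \<in> M" using pushout_leg_M(2)[OF n(2) l(1)] .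
      moreover have "n \<in> hom C (Cod C a) (Cod C m')"
        using pushout_square[OF n(2)] sq sq' by (auto simp: square_iff hom_def)
      ultimately show "sat C M (CEx a c) m'" using n(1) IH[OF q(1) l(4) n(2)] q(4) by auto
    next
      assume "sat C M (CEx a c) m'"
      then obtain q where q: "q \<in> M" "q \<in> hom C (Cod C a) (Cod C m')" "q \<cdot> a = m'"
        "sat C M c q" by auto
      have "\<exists>l \<in> M. Dom C l = Cod C ks \<and> l \<cdot> ks = k \<and> pushout C os l q h'"
        using restrict_complement_context[of "oleg r" k q a h' ks os] P' legs q a aA Q
        by (auto simp: hom_def)
      then obtain l where l: "l \<in> M" "Dom C l = Cod C ks" "l \<cdot> ks = k" "pushout C os l q h'"
        by blast
      have "pushout C (ileg r) (l \<cdot> ks) m h" using P l(3) by simp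
      from pushout_decomp[OF Q' this M_Arr[OF l(1)] l(2)] obtain n where
        n: "n \<cdot> aa = m" "pushout C ii l n h" by blast
      have nM: "n \<in> M" using pushout_leg_M(2)[OF n(2) l(1)] .
      moreover have "n \<in> hom C (Cod C aa) (Cod C m)"
        using pushout_square[OF n(2)] sq sq' by (auto simp: square_iff hom_def)
      ultimately show "sat C M (CEx aa (Trans C c (Rule os ii))) m"
        using n(1) IH[OF nM n(2) l(4)] q(4) by auto
    qed
  qed
next
  case (CNot c)
  then show ?case by simp
next
  case (CConj J c)
  have "sat C M (Trans C (c j) r) m \<longleftrightarrow> sat C M (c j) m'" if "j \<in> J" for j
    using CConj.IH[of "c j" r m k h m' h'] CConj.prems that by simp
  then show ?case by simp
qed

end

section \<open>Sequences of rule applications and composite rules\<close>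

text \<open>
  How an application \<open>d\<close> of \<open>r\<^sub>1\<close> to \<open>X\<^sub>0\<close> extends to the composition diagram: \<open>n : N\<^sub>2\<^sub>1 \<rightarrow> X\<^sub>1\<close>,
  \<open>l : K\<^sub>1' \<rightarrow> L\<close> and \<open>m21 : I\<^sub>2\<^sub>1 \<rightarrow> X\<^sub>0\<close>, where \<open>L\<close> is the context object of \<open>d\<close>, such that \<open>d\<close> is the
  vertical pasting of two double pushouts, the lower one being an application of
  \<open>N\<^sub>2\<^sub>1 \<leftarrow> K\<^sub>1' \<rightarrow> I\<^sub>2\<^sub>1\<close> at \<open>m21\<close>.
\<close>

definition extends ::
    "('o, 'a) cat \<Rightarrow> 'a set \<Rightarrow> 'a composition \<Rightarrow> 'a dpo \<Rightarrow> 'a \<Rightarrow> 'a \<Rightarrow> 'a \<Rightarrow> bool" where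
  "extends C M D d n l m21 \<longleftrightarrow>
     n \<in> M \<and> l \<in> M \<and> m21 \<in> M \<and>
     n \<cdot>\<^bsub>C\<^esub> nO D = comatch d \<and> l \<cdot>\<^bsub>C\<^esub> k1 D = ctxt d \<and> m21 \<cdot>\<^bsub>C\<^esub> pI D = amatch d \<and>
     pushout C (g1 D) l n (out_emb d) \<and> pushout C (eI D) l m21 (in_emb d)"

section \<open>The diagrams relating a two-step sequence to a step of the composite\<close>

context M_adhesive begin

text \<open>The first conclusion is the top of the cube over \<open>P2\<close> with vertical
  morphisms \<open>z2\<close>, \<open>u1\<close>, \<open>y2\<close> and \<open>h1\<close>; its side
  faces are \<open>A\<close>, \<open>B\<close>, \<open>P1\<close> and the pullback that defines
  \<open>w\<close>. The second follows by pasting the first onto \<open>P1\<close> and cutting the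
  resulting pushout along \<open>P2\<close>, read as a pullback.\<close>

lemma pushout_intersection:
  assumes P1: "pushout C u1 l1 n h1" and P2: "pushout C u2 l2 n h2"
    and M: "u1 \<in> M" "u2 \<in> M" "l2 \<in> M"
    and A: "pullback C z2 z1 u2 u1" and B: "pullback C y2 y1 h2 h1"
  obtains w where "pushout C z1 w l1 y1" "pushout C z2 w l2 y2"
proof -
  have sq: "square C u1 l1 n h1" "square C u2 l2 n h2" "square C z2 z1 u2 u1" "square C y2 y1 h2 h1"
    using P1 P2 A B by (auto dest: pushout_square pullback_square)
  have hM: "h1 \<in> M" "h2 \<in> M" using pushout_leg_M(1) P1 P2 M by blast+
  have yM: "y2 \<in> M" using M_pullback[OF pullback_sym[OF B] hM(1)] .
  have xM: "z2 \<in> M" using M_pullback[OF pullback_sym[OF A] M(1)] .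
  \<comment> \<open>Rewriting \<open>n \<cdot> u2\<close> as \<open>h2 \<cdot> l2\<close> places
    this rectangle over \<open>B\<close>, so decomposing it yields \<open>w\<close>.\<close>
  have "pullback C z2 (l1 \<cdot> z1) (n \<cdot> u2) h1"
    using pullback_paste[OF A pushout_M_pullback[OF P1 M(1)]] .
  then have "pullback C z2 (l1 \<cdot> z1) (h2 \<cdot> l2) h1" using sq(2) by (simp add: square_iff)
  moreover have "l2 \<in> Arr C" "Cod C l2 = Dom C h2" using sq(2) by (auto simp: square_iff)
  ultimately obtain w where w: "y1 \<cdot> w = l1 \<cdot> z1" "pullback C z2 w l2 y2"
    using pullback_decomp[OF B] by blast
  have wsq: "square C z2 w l2 y2" using w(2) by (rule pullback_square)
  have "square C z1 w l1 y1"
    using w(1) wsq sq(1,3,4) by (auto simp: square_iff)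
  then have 1: "pushout C z1 w l1 y1"
    using M_vK[OF P2 M(2)] xM M(1) yM hM pushout_M_pullback[OF P1 M(1)] A B w(2)
      pullback_sym pullback_square
    unfolding M_van_kampen_def by blast
  have "pushout C w (u1 \<cdot> z1) (h1 \<cdot> y1) n"
    using pushout_paste[OF pushout_sym[OF 1] pushout_sym[OF P1]] .
  then have "pushout C w (u2 \<cdot> z2) (h2 \<cdot> y2) n" using sq(3,4) by (simp add: square_iff)
  moreover have "w \<in> M" using M_pullback[OF w(2) M(3)] .
  moreover have "pullback C l2 u2 h2 n" using pushout_M_pullback[OF P2 M(2)] by (rule pullback_sym)
  moreover have "square C w z2 y2 l2" using wsq by (rule square_sym)
  ultimately have "pushout C w z2 y2 l2" using pushout_pullback_decomp hM(2) by blast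
  then show thesis using 1 that pushout_sym by blast
qed

text \<open>Membership of \<open>k1 D\<close> comes backwards from \<open>nO D\<close>, since the
  square of the complement is also a pullback. The remaining morphisms inherit it through pushouts
  or pullbacks, and the composite legs by composition.\<close>

lemma comp_diagram_M:
  assumes "comp_diagram C M r2 r1 \<mu> D" "linear_rule C M r1" "linear_rule C M r2"
  shows "nI D \<in> M" "nO D \<in> M" "k1 D \<in> M" "g1 D \<in> M" "g2 D \<in> M" "pI D \<in> M" "eI D \<in> M" "eO D \<in> M"
    "x1 D \<in> M" "x2 D \<in> M"
    "linear_rule C M (fst (composite C M (r2, c2) (r1, c1) D))"
proof -
  have legs: "ileg r1 \<in> M" "oleg r1 \<in> M" "ileg r2 \<in> M" "oleg r2 \<in> M"
    using assms(2,3) by (auto simp: linear_rule_def)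
  have D: "fst \<mu> \<in> M" "snd \<mu> \<in> M" "pushout C (fst \<mu>) (snd \<mu>) (nI D) (nO D)"
    "pushout C (ileg r2) (k2 D) (nI D) (g2 D)" "pushout C (oleg r1) (k1 D) (nO D) (g1 D)"
    "pushout C (oleg r2) (k2 D) (pO D) (eO D)" "pushout C (ileg r1) (k1 D) (pI D) (eI D)"
    "pullback C (x2 D) (x1 D) (g2 D) (g1 D)"
    using assms(1) by (auto simp: comp_diagram_def pushout_complement_def)
  show 1: "nI D \<in> M" "nO D \<in> M"
    using pushout_leg_M(2)[OF D(3) D(2)] pushout_leg_M(1)[OF D(3) D(1)] .
  show 2: "g1 D \<in> M" "g2 D \<in> M"
    using pushout_leg_M(1)[OF D(5) legs(2)] pushout_leg_M(1)[OF D(4) legs(3)] .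
  show k1: "k1 D \<in> M" using pushout_leg_M(3)[OF D(5) legs(2) 1(2)] .
  show "pI D \<in> M" using pushout_leg_M(2)[OF D(7) k1] .
  show e: "eI D \<in> M" "eO D \<in> M"
    using pushout_leg_M(1)[OF D(7) legs(1)] pushout_leg_M(1)[OF D(6) legs(4)] .
  show x: "x1 D \<in> M" "x2 D \<in> M"
    using M_pullback[OF D(8) 2(2)] M_pullback[OF pullback_sym[OF D(8)] 2(1)] .
  have sq: "square C (ileg r2) (k2 D) (nI D) (g2 D)" "square C (oleg r1) (k1 D) (nO D) (g1 D)"
    "square C (oleg r2) (k2 D) (pO D) (eO D)" "square C (ileg r1) (k1 D) (pI D) (eI D)"
    "square C (x2 D) (x1 D) (g2 D) (g1 D)"
    using D by (auto dest: pushout_square pullback_square)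
  have c: "Cod C (x2 D) = Dom C (eO D)" "Cod C (x1 D) = Dom C (eI D)" "Dom C (x1 D) = Dom C (x2 D)"
    using sq by (auto simp: square_iff)
  then show "linear_rule C M (fst (composite C M (r2, c2) (r1, c1) D))"
    using e x M_comp M_Arr by (simp add: linear_rule_def composite_def)
qed

text \<open>A complement suffices for a rule application, because the pushout on the output side
  exists along \<open>oleg r\<close>.\<close>

lemma matches_iff_dpo_step:
  assumes "linear_rule C M r"
  shows "m \<in> matches C M r X \<longleftrightarrow> (\<exists>Y. dpo_step C M r m X Y)"
proof
  assume "m \<in> matches C M r X"
  then obtain k h where m: "m \<in> M" "m \<in> hom C (Cod C (ileg r)) X"
    and P: "pushout C (ileg r) k m h" by (auto simp: matches_def pushout_complement_def)
  have "k \<in> Arr C" "Dom C (oleg r) = Dom C k"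
    using P assms by (auto dest!: pushout_square simp: square_iff linear_rule_def)
  then obtain p q where "pushout C (oleg r) k p q"
    using M_pushout_exists[of "oleg r" k] assms by (auto simp: linear_rule_def)
  then have "dpo_diagram C M r m X \<lparr>amatch = m, ctxt = k, in_emb = h, out_emb = q, comatch = p\<rparr>"
    using m P by (simp add: dpo_diagram_def pushout_complement_def)
  then show "\<exists>Y. dpo_step C M r m X Y" unfolding dpo_step_def by blast
qed (auto simp: matches_def dpo_step_def dpo_diagram_def)

lemma dpo_stepI:
  assumes "m \<in> M" "Cod C m = X" "pushout C (ileg r) k m h" "pushout C (oleg r) k p q" "Cod C p = Y"
  shows "dpo_step C M r m X Y"
proof -
  have "m \<in> hom C (Cod C (ileg r)) X"
    using assms(1,2) pushout_square[OF assms(3)] by (auto simp: hom_def square_iff)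
  then have "dpo_diagram C M r m X \<lparr>amatch = m, ctxt = k, in_emb = h, out_emb = q, comatch = p\<rparr>"
    using assms by (simp add: dpo_diagram_def pushout_complement_def)
  then show ?thesis unfolding dpo_step_def using assms(5) by force
qed

lemma dpo_stepE:
  assumes "dpo_step C M r m X Y"
  obtains k h p q where "m \<in> M" "m \<in> hom C (Cod C (ileg r)) X"
    "pushout C (ileg r) k m h" "pushout C (oleg r) k p q" "Cod C p = Y"
  using assms unfolding dpo_step_def dpo_diagram_def pushout_complement_def by blast

text \<open>The double pushouts of the second step and of the composite end in the same corner, so
  \<open>Y\<close> is shared literally and no isomorphism intervenes. The directions consist of
  cutting and pasting along \<open>x1 D\<close> and \<open>x2 D\<close>.\<close>

lemma extends_dpo_step_iff:
  assumes D: "comp_diagram C M r2 r1 \<mu> D" and r1: "linear_rule C M r1" and r2: "linear_rule C M r2"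
    and d: "dpo_diagram C M r1 m1 X0 d" and E: "extends C M D d n l m21"
  shows "dpo_step C M r2 (n \<cdot> nI D) (result C d) Y \<longleftrightarrow>
    dpo_step C M (fst (composite C M (r2, c2) (r1, c1) D)) m21 X0 Y"
proof -
  have legs: "ileg r1 \<in> M" "oleg r1 \<in> M" "ileg r2 \<in> M" "oleg r2 \<in> M"
    using r1 r2 by (auto simp: linear_rule_def)
  note DM = comp_diagram_M[OF D r1 r2]
  have P: "pushout C (ileg r2) (k2 D) (nI D) (g2 D)" and Q: "pushout C (oleg r2) (k2 D) (pO D) (eO D)"
    and R: "pullback C (x2 D) (x1 D) (g2 D) (g1 D)"
    using D by (auto simp: comp_diagram_def pushout_complement_def)
  have nl: "n \<in> M" "l \<in> M" "m21 \<in> M" and A: "pushout C (g1 D) l n (out_emb d)"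
    and B: "pushout C (eI D) l m21 (in_emb d)" and nO: "n \<cdot> nO D = comatch d"
    using E by (auto simp: extends_def)
  have sq: "square C (ileg r2) (k2 D) (nI D) (g2 D)" "square C (oleg r2) (k2 D) (pO D) (eO D)"
    "square C (x2 D) (x1 D) (g2 D) (g1 D)" "square C (g1 D) l n (out_emb d)"
    "square C (eI D) l m21 (in_emb d)"
    using P Q R A B by (auto dest: pushout_square pullback_square)
  have sqN: "square C (fst \<mu>) (snd \<mu>) (nI D) (nO D)" "square C (oleg r1) (k1 D) (nO D) (g1 D)"
    using D by (auto simp: comp_diagram_def pushout_complement_def dest: pushout_square)
  have d': "pushout C (oleg r1) (ctxt d) (comatch d) (out_emb d)"
    "pushout C (ileg r1) (ctxt d) m1 (in_emb d)" "Cod C m1 = X0"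
    using d by (auto simp: dpo_diagram_def pushout_complement_def hom_def)
  have X1: "Cod C n = result C d" "Cod C m21 = X0"
    using sq(4,5) pushout_square[OF d'(1)] pushout_square[OF d'(2)] d'(3) by (auto simp: square_iff)
  have nnI: "n \<cdot> nI D \<in> M" "Cod C (n \<cdot> nI D) = result C d"
    using M_comp[OF DM(1) nl(1)] sq(1,4) sqN X1 by (auto simp: square_iff)
  show ?thesis
  proof
    assume "dpo_step C M r2 (n \<cdot> nI D) (result C d) Y"
    then obtain c h p q where S: "pushout C (ileg r2) c (n \<cdot> nI D) h" "pushout C (oleg r2) c p q"
      "Cod C p = Y" by (rule dpo_stepE)
    have nI: "nI D \<in> Arr C" "Dom C (nI D) = Cod C (ileg r2)" "Cod C (nI D) = Dom C n"
      using sq(1,4) sqN by (auto simp: square_iff)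
    \<comment> \<open>The complement of the second step is restricted from the intermediate object
      to \<open>N\<^sub>2\<^sub>1\<close>.\<close>
    obtain l2 where l2: "l2 \<in> M" "Dom C l2 = Cod C (k2 D)" "l2 \<cdot> k2 D = c" "pushout C (g2 D) l2 n h"
      using restrict_complement_context[OF S(1) legs(3) nl(1) nI P] by blast
    have "h \<in> M" using pushout_leg_M(1)[OF S(1) legs(3)] .
    moreover have "out_emb d \<in> Arr C" "Cod C h = Cod C (out_emb d)"
      using sq(4) pushout_square[OF l2(4)] by (auto simp: square_iff)
    \<comment> \<open>The intersection of the two context objects inside the intermediate object; it
      becomes the context object of the composite step.\<close>
    ultimately obtain y2 y1 where Y: "pullback C y2 y1 h (out_emb d)"
      using M_pullback_exists[of h "out_emb d"] by blast
    obtain w where w: "pushout C (x1 D) w l y1" "pushout C (x2 D) w l2 y2"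
      using pushout_intersection[OF A l2(4) DM(4,5) l2(1) R Y] .
    have "pushout C (oleg r2) (l2 \<cdot> k2 D) p q" using S(2) l2(3) by simp
    from pushout_decomp[OF Q this M_Arr[OF l2(1)] l2(2)] obtain t where
      t: "t \<cdot> pO D = p" "pushout C (eO D) l2 t q" by blast
    have t': "Cod C t = Y"
      using t S(3) pushout_square[OF t(2)] sq(2) by (auto simp: square_iff)
    have "pushout C (eI D \<cdot> x1 D) w m21 (in_emb d \<cdot> y1)"
      using pushout_paste[OF pushout_sym[OF w(1)] pushout_sym[OF B]] by (rule pushout_sym)
    moreover have "pushout C (eO D \<cdot> x2 D) w t (q \<cdot> y2)"
      using pushout_paste[OF pushout_sym[OF w(2)] pushout_sym[OF t(2)]] by (rule pushout_sym)
    ultimately show "dpo_step C M (fst (composite C M (r2, c2) (r1, c1) D)) m21 X0 Y"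
      using dpo_stepI[OF nl(3) X1(2), of "fst (composite C M (r2, c2) (r1, c1) D)"] t'
      by (simp add: composite_def)
  next
    assume "dpo_step C M (fst (composite C M (r2, c2) (r1, c1) D)) m21 X0 Y"
    then obtain w h t q where S: "pushout C (eI D \<cdot> x1 D) w m21 h" "pushout C (eO D \<cdot> x2 D) w t q"
      "Cod C t = Y" by (rule dpo_stepE) (simp add: composite_def)
    have xA: "x1 D \<in> Arr C" "x2 D \<in> Arr C" "eI D \<in> Arr C" "eO D \<in> Arr C" "g2 D \<in> Arr C"
      "Cod C (x1 D) = Dom C (eI D)" "Cod C (x2 D) = Dom C (eO D)" "Cod C (x2 D) = Dom C (g2 D)"
      "Dom C (x1 D) = Dom C (x2 D)"
      using sq by (auto simp: square_iff)
    have wA: "w \<in> Arr C" "Dom C w = Dom C (x1 D)"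
      using pushout_square[OF S(1)] xA by (auto simp: square_iff)
    \<comment> \<open>The context object of the first step is rebuilt as the pushout of
      \<open>w\<close> along \<open>x1 D\<close>. Cutting the input pushout of the composite there
      leaves a complement of \<open>eI D\<close> and \<open>m21\<close>.\<close>
    obtain l' y where W1: "pushout C (x1 D) w l' y"
      using M_pushout_exists[OF DM(9) wA(1)] wA(2) by metis
    obtain v where v: "pushout C l' (eI D) v m21"
      using pushout_decomp[OF pushout_sym[OF W1] pushout_sym[OF S(1)] xA(3)]
        pushout_square[OF W1] xA by (auto simp: square_iff)
    \<comment> \<open>Both \<open>l'\<close> and \<open>l\<close> belong to complements of the same
      pair, so the isomorphism \<open>e\<close> replaces the rebuilt \<open>l'\<close> by the given
      \<open>l\<close>.\<close>
    from pushout_complement_unique[OF pushout_sym[OF v] B DM(7)] obtain e where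
      e: "is_iso C e" "Dom C e = Cod C l'" "e \<cdot> l' = l" by blast
    have W: "pushout C (x1 D) w l (e \<cdot> y)"
      using pushout_comp_iso[OF W1 e(1,2)] e(3) by simp
    have "pushout C w (g1 D \<cdot> x1 D) (out_emb d \<cdot> (e \<cdot> y)) n"
      using pushout_paste[OF pushout_sym[OF W] pushout_sym[OF A]] .
    \<comment> \<open>The equation \<open>g1 D \<cdot> x1 D = g2 D \<cdot> x2 D\<close> allows the
      same pushout to be cut at \<open>x2 D\<close> instead of \<open>x1 D\<close>, which leads from
      the first step to the second.\<close>
    then have N: "pushout C w (g2 D \<cdot> x2 D) (out_emb d \<cdot> (e \<cdot> y)) n" using sq(3) by (simp add: square_iff)
    obtain l2 y2 where W2: "pushout C (x2 D) w l2 y2"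
      using M_pushout_exists[OF DM(10) wA(1)] wA(2) xA(9) by metis
    have c2: "Cod C (x2 D) = Dom C l2" using pushout_square[OF W2] by (simp add: square_iff)
    obtain h2 where h2: "pushout C l2 (g2 D) h2 n"
      using pushout_decomp[OF pushout_sym[OF W2] N xA(5)] xA(8) by auto
    obtain q2 where q2: "pushout C l2 (eO D) q2 t"
      using pushout_decomp[OF pushout_sym[OF W2] pushout_sym[OF S(2)] xA(4)] xA(7) by auto
    have "pushout C (ileg r2) (l2 \<cdot> k2 D) (n \<cdot> nI D) h2"
      using pushout_paste[OF P pushout_sym[OF h2]] .
    moreover have "pushout C (oleg r2) (l2 \<cdot> k2 D) (t \<cdot> pO D) q2"
      using pushout_paste[OF Q pushout_sym[OF q2]] .
    moreover have "Cod C (t \<cdot> pO D) = Y"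
      using sq(2) pushout_square[OF q2] S(3) by (auto simp: square_iff)
    ultimately show "dpo_step C M r2 (n \<cdot> nI D) (result C d) Y"
      using dpo_stepI nnI by blast
  qed
qed

text \<open>The input leg of the composite is \<open>eI D \<cdot> x1 D\<close>. Cutting its pushout
  at \<open>x1 D\<close> leaves a pushout over \<open>eI D\<close>, which is pasted below the square
  defining \<open>I\<^sub>2\<^sub>1\<close>.\<close>

lemma comp_match_first_match:
  assumes D: "comp_diagram C M r2 r1 \<mu> D" and r1: "linear_rule C M r1" and r2: "linear_rule C M r2"
    and m: "m21 \<in> matches C M (fst (composite C M (r2, c2) (r1, c1) D)) X0"
  shows "m21 \<cdot> pI D \<in> matches C M r1 X0"
proof -
  note DM = comp_diagram_M[OF D r1 r2]
  have Q: "pushout C (ileg r1) (k1 D) (pI D) (eI D)" and R: "pullback C (x2 D) (x1 D) (g2 D) (g1 D)"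
    and P: "pushout C (oleg r1) (k1 D) (nO D) (g1 D)"
    using D by (auto simp: comp_diagram_def pushout_complement_def)
  have sq: "square C (ileg r1) (k1 D) (pI D) (eI D)" "square C (x2 D) (x1 D) (g2 D) (g1 D)"
    "square C (oleg r1) (k1 D) (nO D) (g1 D)"
    using Q R P by (auto dest: pushout_square pullback_square)
  have xA: "x1 D \<in> Arr C" "eI D \<in> Arr C" "Cod C (x1 D) = Dom C (eI D)" "Cod C (eI D) = Cod C (pI D)"
    "pI D \<in> Arr C" "Dom C (pI D) = Cod C (ileg r1)"
    using sq by (auto simp: square_iff)
  obtain w h where S: "pushout C (eI D \<cdot> x1 D) w m21 h" and mM: "m21 \<in> M" "Cod C m21 = X0"
    using m by (auto simp: matches_def composite_def pushout_complement_def hom_def)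
  have wA: "w \<in> Arr C" "Dom C w = Dom C (x1 D)" "Dom C m21 = Cod C (pI D)" "m21 \<in> Arr C"
    using pushout_square[OF S] xA by (auto simp: square_iff)
  obtain l' y where W1: "pushout C (x1 D) w l' y"
    using M_pushout_exists[OF DM(9) wA(1)] wA(2) by metis
  obtain v where v: "pushout C l' (eI D) v m21"
    using pushout_decomp[OF pushout_sym[OF W1] pushout_sym[OF S] xA(2)]
      pushout_square[OF W1] xA by (auto simp: square_iff)
  have "pushout C (ileg r1) (l' \<cdot> k1 D) (m21 \<cdot> pI D) v"
    using pushout_paste[OF Q pushout_sym[OF v]] .
  moreover have "m21 \<cdot> pI D \<in> M" using M_comp[OF DM(6) mM(1)] wA(3) by simp
  moreover have "m21 \<cdot> pI D \<in> hom C (Cod C (ileg r1)) X0"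
    using wA xA mM by (simp add: hom_def)
  ultimately show ?thesis unfolding matches_def pushout_complement_def by blast
qed

text \<open>The construction runs from the input side to the output side: restricting the complement
  in \<open>d\<close> along \<open>m21\<close> gives \<open>l\<close>, and cutting the output
  pushout of \<open>d\<close> at \<open>k1 D\<close> gives \<open>n\<close>. The overlap is again
  \<open>\<mu>\<close>, because the square defining \<open>N\<^sub>2\<^sub>1\<close> is a pullback
  and \<open>n\<close> is monic.\<close>

lemma extends_of_comp_match:
  assumes D: "comp_diagram C M r2 r1 \<mu> D" and r1: "linear_rule C M r1" and r2: "linear_rule C M r2"
    and m: "m21 \<in> M" "Dom C m21 = Cod C (pI D)" and d: "dpo_diagram C M r1 (m21 \<cdot> pI D) X0 d"
  shows "\<exists>n l. extends C M D d n l m21 \<and> pullback C (fst \<mu>) (snd \<mu>) (n \<cdot> nI D) (comatch d)"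
proof -
  note DM = comp_diagram_M[OF D r1 r2]
  have legs: "ileg r1 \<in> M" "oleg r1 \<in> M" using r1 by (auto simp: linear_rule_def)
  have N: "pushout C (fst \<mu>) (snd \<mu>) (nI D) (nO D)" and P: "pushout C (oleg r1) (k1 D) (nO D) (g1 D)"
    and Q: "pushout C (ileg r1) (k1 D) (pI D) (eI D)" and uM: "fst \<mu> \<in> M"
    using D by (auto simp: comp_diagram_def pushout_complement_def)
  have d': "pushout C (oleg r1) (ctxt d) (comatch d) (out_emb d)"
    "pushout C (ileg r1) (ctxt d) (m21 \<cdot> pI D) (in_emb d)" "amatch d = m21 \<cdot> pI D"
    using d by (auto simp: dpo_diagram_def pushout_complement_def)
  have sq: "square C (ileg r1) (k1 D) (pI D) (eI D)" "square C (oleg r1) (k1 D) (nO D) (g1 D)"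
    "square C (fst \<mu>) (snd \<mu>) (nI D) (nO D)"
    using Q P N by (auto dest: pushout_square)
  have pI: "pI D \<in> Arr C" "Dom C (pI D) = Cod C (ileg r1)" using sq by (auto simp: square_iff)
  obtain l where l: "l \<in> M" "Dom C l = Cod C (k1 D)" "l \<cdot> k1 D = ctxt d"
    "pushout C (eI D) l m21 (in_emb d)"
    using restrict_complement_context[OF d'(2) legs(1) m(1) pI m(2)[symmetric] Q] by blast
  have "pushout C (oleg r1) (l \<cdot> k1 D) (comatch d) (out_emb d)" using d'(1) l(3) by simp
  from pushout_decomp[OF P this M_Arr[OF l(1)] l(2)] obtain n where
    n: "n \<cdot> nO D = comatch d" "pushout C (g1 D) l n (out_emb d)" by blast
  have nM: "n \<in> M" using pushout_leg_M(2)[OF n(2) l(1)] .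
  have "Dom C n = Cod C (nI D)" using pushout_square[OF n(2)] sq by (auto simp: square_iff)
  then have "pullback C (fst \<mu>) (snd \<mu>) (n \<cdot> nI D) (n \<cdot> nO D)"
    using pullback_extend_monic[OF pushout_M_pullback[OF N uM] M_monic[OF nM]] by blast
  moreover have "extends C M D d n l m21"
    unfolding extends_def using nM l n m d'(3) by simp
  ultimately show ?thesis using n(1) by auto
qed

lemma extends_concurrent:
  assumes E: "extends C M D d n l m21" and D: "comp_diagram C M r2 r1 \<mu> D"
    and P: "pullback C (fst \<mu>) (snd \<mu>) (n \<cdot> nI D) (comatch d)"
  shows "concurrent C d (n \<cdot> nI D) \<mu> D m21"
proof -
  have N: "square C (fst \<mu>) (snd \<mu>) (nI D) (nO D)" "square C (oleg r1) (k1 D) (nO D) (g1 D)"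
    using D by (auto simp: comp_diagram_def pushout_complement_def dest: pushout_square)
  have S: "square C (g1 D) l n (out_emb d)" "square C (eI D) l m21 (in_emb d)"
    and E': "n \<cdot> nO D = comatch d" "l \<cdot> k1 D = ctxt d" "m21 \<cdot> pI D = amatch d"
    using E by (auto simp: extends_def dest: pushout_square)
  have c: "Cod C (n \<cdot> nO D) = Cod C n" "Cod C (l \<cdot> k1 D) = Cod C l"
    using N S by (auto simp: square_iff)
  have "n \<in> hom C (Cod C (nI D)) (result C d)" "l \<in> hom C (Cod C (k1 D)) (Cod C (ctxt d))"
    using N S c E' by (auto simp: square_iff hom_def)
  moreover have "out_emb d \<cdot> l = n \<cdot> g1 D" "m21 \<cdot> eI D = in_emb d \<cdot> l"
    using S by (auto simp: square_iff)
  ultimately show ?thesis unfolding concurrent_def using P E' by blast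
qed

text \<open>First \<open>n\<close> is fixed by the legs \<open>nI D\<close> and \<open>nO D\<close>,
  then \<open>l\<close> because \<open>out_emb d\<close> is monic, and finally \<open>m21\<close> by
  the legs \<open>pI D\<close> and \<open>eI D\<close>.\<close>

lemma concurrent_match_unique:
  assumes D: "comp_diagram C M r2 r1 \<mu> D" and r1: "linear_rule C M r1"
    and d: "dpo_diagram C M r1 m1 X0 d"
    and A: "concurrent C d m2 \<mu> D m21" and B: "concurrent C d m2 \<mu> D m21'"
    and m: "m21 \<in> Arr C" "m21' \<in> Arr C" "Dom C m21 = Cod C (pI D)" "Dom C m21' = Cod C (pI D)"
  shows "m21 = m21'"
proof -
  have N: "pushout C (fst \<mu>) (snd \<mu>) (nI D) (nO D)" and Q: "pushout C (ileg r1) (k1 D) (pI D) (eI D)"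
    using D by (auto simp: comp_diagram_def pushout_complement_def)
  have d': "pushout C (oleg r1) (ctxt d) (comatch d) (out_emb d)"
    using d by (auto simp: dpo_diagram_def)
  have "oleg r1 \<in> M" using r1 by (simp add: linear_rule_def)
  then have out: "monic C (out_emb d)" using M_monic[OF pushout_leg_M(1)[OF d']] by blast
  have dom: "Dom C (out_emb d) = Cod C (ctxt d)" using pushout_square[OF d'] by (simp add: square_iff)
  obtain n l where n: "n \<in> hom C (Cod C (nI D)) (result C d)" "l \<in> hom C (Cod C (k1 D)) (Cod C (ctxt d))"
    "n \<cdot> nI D = m2" "n \<cdot> nO D = comatch d" "out_emb d \<cdot> l = n \<cdot> g1 D"
    "m21 \<cdot> pI D = amatch d" "m21 \<cdot> eI D = in_emb d \<cdot> l"
    using A unfolding concurrent_def by blast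
  obtain n' l' where n': "n' \<in> hom C (Cod C (nI D)) (result C d)" "l' \<in> hom C (Cod C (k1 D)) (Cod C (ctxt d))"
    "n' \<cdot> nI D = m2" "n' \<cdot> nO D = comatch d" "out_emb d \<cdot> l' = n' \<cdot> g1 D"
    "m21' \<cdot> pI D = amatch d" "m21' \<cdot> eI D = in_emb d \<cdot> l'"
    using B unfolding concurrent_def by blast
  have "n = n'" using pushout_eq[OF N, of n n'] n n' by (simp add: hom_def)
  then have "l = l'" using monic_eq[OF out, of l l'] n n' dom by (simp add: hom_def)
  then show ?thesis using pushout_eq[OF Q m] n(6,7) n'(6,7) by simp
qed

text \<open>The data are recovered in the opposite order: \<open>l\<close> from the monic
  \<open>in_emb d\<close>, then \<open>n\<close> by viewing \<open>N\<^sub>2\<^sub>1\<close> as the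
  pushout with legs \<open>nO D\<close> and \<open>g1 D\<close>, and from \<open>n\<close> the
  second match.\<close>

lemma concurrent_second_unique:
  assumes D: "comp_diagram C M r2 r1 \<mu> D" and r1: "linear_rule C M r1"
    and d: "dpo_diagram C M r1 m1 X0 d"
    and A: "concurrent C d m2 \<mu> D m21" and B: "concurrent C d m2' \<mu> D m21"
  shows "m2 = m2'"
proof -
  have P: "pushout C (oleg r1) (k1 D) (nO D) (g1 D)" and N: "pushout C (fst \<mu>) (snd \<mu>) (nI D) (nO D)"
    using D by (auto simp: comp_diagram_def pushout_complement_def)
  have d': "pushout C (ileg r1) (ctxt d) m1 (in_emb d)"
    using d by (auto simp: dpo_diagram_def pushout_complement_def)
  have "ileg r1 \<in> M" using r1 by (simp add: linear_rule_def)
  then have inn: "monic C (in_emb d)" using M_monic[OF pushout_leg_M(1)[OF d']] by blast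
  have dom: "Dom C (in_emb d) = Cod C (ctxt d)" "Cod C (nO D) = Cod C (nI D)"
    using pushout_square[OF d'] pushout_square[OF N] by (auto simp: square_iff)
  obtain n l where n: "n \<in> hom C (Cod C (nI D)) (result C d)" "l \<in> hom C (Cod C (k1 D)) (Cod C (ctxt d))"
    "n \<cdot> nI D = m2" "n \<cdot> nO D = comatch d" "out_emb d \<cdot> l = n \<cdot> g1 D" "m21 \<cdot> eI D = in_emb d \<cdot> l"
    using A unfolding concurrent_def by blast
  obtain n' l' where n': "n' \<in> hom C (Cod C (nI D)) (result C d)" "l' \<in> hom C (Cod C (k1 D)) (Cod C (ctxt d))"
    "n' \<cdot> nI D = m2'" "n' \<cdot> nO D = comatch d" "out_emb d \<cdot> l' = n' \<cdot> g1 D" "m21 \<cdot> eI D = in_emb d \<cdot> l'"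
    using B unfolding concurrent_def by blast
  have "l = l'" using monic_eq[OF inn, of l l'] n(2,6) n'(2,6) dom by (simp add: hom_def)
  then have "n \<cdot> g1 D = n' \<cdot> g1 D" using n(5) n'(5) by simp
  then have "n = n'" using pushout_eq[OF P, of n n'] n(1,4) n'(1,4) dom by (simp add: hom_def)
  then show ?thesis using n(3) n'(3) by simp
qed

end

section \<open>Constructing composition diagrams, and transferring admissibility\<close>

context dpo_setting begin

lemma overlap_M:
  assumes P: "pullback C u v m2 m1'" and m: "m2 \<in> M" "m1' \<in> M" and N: "pushout C u v p q"
  obtains n where "n \<in> M" "Dom C n = Cod C p" "n \<cdot> p = m2" "n \<cdot> q = m1'"
proof -
  have uv: "u \<in> M" "v \<in> M" using M_pullback[OF pullback_sym[OF P] m(2)] M_pullback[OF P m(1)] .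
  from pushout_ex[OF N pullback_square[OF P]] obtain n where
    n: "n \<in> Arr C" "Dom C n = Cod C p" "Cod C n = Cod C m2" "n \<cdot> p = m2" "n \<cdot> q = m1'" by blast
  have "n \<in> M" using M_effective_unions[OF uv N m P homI[OF n(1-3)] n(4,5)] .
  then show thesis using that n by blast
qed

text \<open>The input square is also a pullback, so \<open>ctxt d\<close> inherits membership from
  the match; the output pushout passes it on to the comatch.\<close>

lemma comatch_M:
  assumes "dpo_diagram C M r m X d" "linear_rule C M r"
  shows "comatch d \<in> M"
proof -
  have P: "pushout C (ileg r) (ctxt d) m (in_emb d)" "m \<in> M"
    and Q: "pushout C (oleg r) (ctxt d) (comatch d) (out_emb d)"
    using assms(1) by (auto simp: dpo_diagram_def pushout_complement_def)
  have "ileg r \<in> M" using assms(2) by (simp add: linear_rule_def)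
  then show ?thesis using pushout_leg_M(3)[OF P(1)] pushout_leg_M(2)[OF Q] P(2) by blast
qed

text \<open>The construction runs from the output side to the input side: effective unions give
  \<open>n\<close>, restricting the output square along \<open>n\<close> gives \<open>l\<close>, and
  cutting the input pushout of \<open>d\<close> at \<open>k1 D\<close> gives
  \<open>m21\<close>.\<close>

lemma extends_of_matches:
  assumes D: "comp_diagram C M r2 r1 \<mu> D" and r1: "linear_rule C M r1" and r2: "linear_rule C M r2"
    and d: "dpo_diagram C M r1 m1 X0 d" and m2: "m2 \<in> M"
    and P: "pullback C (fst \<mu>) (snd \<mu>) m2 (comatch d)"
  shows "\<exists>n l m21. extends C M D d n l m21 \<and> n \<cdot> nI D = m2"
proof -
  have legs: "ileg r1 \<in> M" "oleg r1 \<in> M" using r1 by (auto simp: linear_rule_def)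
  have N: "pushout C (fst \<mu>) (snd \<mu>) (nI D) (nO D)" and K: "pushout C (oleg r1) (k1 D) (nO D) (g1 D)"
    and Q: "pushout C (ileg r1) (k1 D) (pI D) (eI D)"
    using D by (auto simp: comp_diagram_def pushout_complement_def)
  have d': "pushout C (oleg r1) (ctxt d) (comatch d) (out_emb d)"
    "pushout C (ileg r1) (ctxt d) m1 (in_emb d)" "amatch d = m1"
    using d by (auto simp: dpo_diagram_def pushout_complement_def)
  obtain n where n: "n \<in> M" "Dom C n = Cod C (nI D)" "n \<cdot> nI D = m2" "n \<cdot> nO D = comatch d"
    using overlap_M[OF P m2 comatch_M[OF d r1] N] .
  have nO: "nO D \<in> Arr C" "Dom C (nO D) = Cod C (oleg r1)" "Cod C (nO D) = Dom C n"
    using pushout_square[OF K] pushout_square[OF N] n(2) by (auto simp: square_iff)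
  have "pushout C (oleg r1) (ctxt d) (n \<cdot> nO D) (out_emb d)" using d'(1) n(4) by simp
  from restrict_complement_context[OF this legs(2) n(1) nO K] obtain l where
    l: "l \<in> M" "Dom C l = Cod C (k1 D)" "l \<cdot> k1 D = ctxt d" "pushout C (g1 D) l n (out_emb d)" by blast
  have "pushout C (ileg r1) (l \<cdot> k1 D) m1 (in_emb d)" using d'(2) l(3) by simp
  from pushout_decomp[OF Q this M_Arr[OF l(1)] l(2)] obtain m21 where
    m21: "m21 \<cdot> pI D = m1" "pushout C (eI D) l m21 (in_emb d)" by blast
  have "m21 \<in> M" using pushout_leg_M(2)[OF m21(2) l(1)] .
  then have "extends C M D d n l m21"
    unfolding extends_def using n l m21 d'(3) by simp
  then show ?thesis using n(3) by blast
qed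

text \<open>Both complements over \<open>N\<^sub>2\<^sub>1\<close> are restrictions along
  \<open>n\<close>: one of the output square of \<open>d\<close>, the other of the complement that
  makes \<open>m2\<close> a match.\<close>

lemma comp_diagram_exists:
  assumes r1: "linear_rule C M r1" and r2: "linear_rule C M r2"
    and d: "dpo_diagram C M r1 m1 X0 d" and m2: "m2 \<in> matches C M r2 X1"
    and P: "pullback C u v m2 (comatch d)"
  shows "\<exists>D. comp_diagram C M r2 r1 (u, v) D"
proof -
  have legs: "ileg r1 \<in> M" "oleg r1 \<in> M" "ileg r2 \<in> M" "oleg r2 \<in> M"
    "Dom C (oleg r1) = Dom C (ileg r1)" "Dom C (oleg r2) = Dom C (ileg r2)"
    using r1 r2 by (auto simp: linear_rule_def)
  have m2M: "m2 \<in> M" using m2 by (simp add: matches_def)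
  have cM: "comatch d \<in> M" using comatch_M[OF d r1] .
  have uv: "u \<in> M" "v \<in> M" using M_pullback[OF pullback_sym[OF P] cM] M_pullback[OF P m2M] .
  have Psq: "square C u v m2 (comatch d)" using P by (rule pullback_square)
  obtain p q where N: "pushout C u v p q"
    using M_pushout_exists[OF uv(1) M_Arr[OF uv(2)]] Psq by (auto simp: square_iff)
  obtain n where n: "n \<in> M" "Dom C n = Cod C p" "n \<cdot> p = m2" "n \<cdot> q = comatch d"
    using overlap_M[OF P m2M cM N] .
  have Nsq: "square C u v p q" using N by (rule pushout_square)
  have d': "pushout C (oleg r1) (ctxt d) (n \<cdot> q) (out_emb d)"
    using d n(4) by (auto simp: dpo_diagram_def)
  obtain c h where c: "pushout C (ileg r2) c (n \<cdot> p) h" and hm: "Dom C m2 = Cod C (ileg r2)"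
    using m2 n(3) by (auto simp: matches_def pushout_complement_def hom_def)
  have dq: "Cod C v = Cod C (oleg r1)" "Cod C u = Cod C (ileg r2)"
    using Psq pushout_square[OF d'] n(4) hm by (auto simp: square_iff)
  obtain k1' g1' where K1: "pushout C (oleg r1) k1' q g1'"
    using restrict_complement_exists[OF d' legs(2) n(1)] Nsq dq n(2) by (auto simp: square_iff)
  obtain k2' g2' where K2: "pushout C (ileg r2) k2' p g2'"
    using restrict_complement_exists[OF c legs(3) n(1)] Nsq dq n(2) by (auto simp: square_iff)
  have ks: "square C (oleg r1) k1' q g1'" "square C (ileg r2) k2' p g2'"
    using K1 K2 by (auto dest: pushout_square)
  have ka: "k1' \<in> Arr C" "Dom C (ileg r1) = Dom C k1'" "k2' \<in> Arr C" "Dom C (oleg r2) = Dom C k2'"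
    using ks legs by (auto simp: square_iff)
  obtain pO' eO' where O: "pushout C (oleg r2) k2' pO' eO'"
    using M_pushout_exists[OF legs(4) ka(3,4)] by blast
  obtain pI' eI' where I: "pushout C (ileg r1) k1' pI' eI'"
    using M_pushout_exists[OF legs(1) ka(1,2)] by blast
  have g: "g2' \<in> M" using pushout_leg_M(1)[OF K2 legs(3)] .
  have "g1' \<in> Arr C" "Cod C g2' = Cod C g1'" using ks Nsq by (auto simp: square_iff)
  then obtain x2' x1' where X: "pullback C x2' x1' g2' g1'"
    using M_pullback_exists[OF g] by blast
  have "comp_diagram C M r2 r1 (u, v) \<lparr>nI = p, nO = q, k2 = k2', g2 = g2', k1 = k1', g1 = g1',
      pO = pO', eO = eO', pI = pI', eI = eI', x2 = x2', x1 = x1'\<rparr>"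
    using uv N K1 K2 O I X dq by (simp add: comp_diagram_def pushout_complement_def)
  then show ?thesis by blast
qed

text \<open>The first conjunct of the composite condition moves from \<open>m21\<close> to
  \<open>m1\<close> by \<open>Shift\<close> along \<open>pI D\<close>. For the second, the lower
  double pushout in \<open>extends\<close> is an application of \<open>Rule (g1 D) (eI D)\<close>
  with comatch \<open>n\<close>, so \<open>Trans\<close> moves the condition from \<open>m21\<close>
  to \<open>n\<close>, and \<open>Shift\<close> along \<open>nI D\<close> moves it on to
  \<open>n \<cdot> nI D\<close>.\<close>

lemma extends_adm_iff:
  assumes D: "comp_diagram C M r2 r1 \<mu> D" and r1: "cond_rule C M (r1, c1)" and r2: "cond_rule C M (r2, c2)"
    and d: "dpo_diagram C M r1 m1 X0 d" and E: "extends C M D d n l m21"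
  shows "m21 \<in> adm_matches C M (composite C M (r2, c2) (r1, c1) D) X0 \<longleftrightarrow>
    m1 \<in> adm_matches C M (r1, c1) X0 \<and> n \<cdot> nI D \<in> adm_matches C M (r2, c2) (result C d)"
proof -
  have lin: "linear_rule C M r1" "linear_rule C M r2"
    and over: "cond_over C M c1 (Cod C (ileg r1))" "cond_over C M c2 (Cod C (ileg r2))"
    using r1 r2 by (auto simp: cond_rule_def)
  note DM = comp_diagram_M[OF D lin]
  have N: "square C (fst \<mu>) (snd \<mu>) (nI D) (nO D)" "square C (oleg r1) (k1 D) (nO D) (g1 D)"
    "square C (ileg r1) (k1 D) (pI D) (eI D)" "square C (ileg r2) (k2 D) (nI D) (g2 D)"
    using D by (auto simp: comp_diagram_def pushout_complement_def dest: pushout_square)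
  have E': "n \<in> M" "m21 \<in> M" "m21 \<cdot> pI D = m1" "pushout C (g1 D) l n (out_emb d)"
    "pushout C (eI D) l m21 (in_emb d)"
    using E d by (auto simp: extends_def dpo_diagram_def)
  have S: "square C (g1 D) l n (out_emb d)" "square C (eI D) l m21 (in_emb d)"
    using E' by (auto dest: pushout_square)
  have doms: "Dom C (pI D) = Cod C (ileg r1)" "Dom C (nI D) = Cod C (ileg r2)"
    "Dom C m21 = Cod C (pI D)" "Dom C n = Cod C (nI D)" "Cod C (g1 D) = Cod C (nI D)"
    "Dom C (g1 D) = Dom C (eI D)"
    using N S by (auto simp: square_iff)
  have "sat C M (Shift C M c1 (pI D)) m21 \<longleftrightarrow> sat C M c1 m1"
    using sat_Shift[of c1 "pI D" m21] over doms DM E' by simp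
  moreover have "cond_over C M (Shift C M c2 (nI D)) (Cod C (g1 D))"
    using cond_over_Shift[of c2 "nI D"] over doms DM(1) by simp
  then have "sat C M (Trans C (Shift C M c2 (nI D)) (Rule (g1 D) (eI D))) m21 \<longleftrightarrow>
      sat C M (Shift C M c2 (nI D)) n"
    using sat_Trans[of _ "Rule (g1 D) (eI D)" m21 l "in_emb d" n "out_emb d"] DM(4,7) doms(6) E'
    by (simp add: linear_rule_def)
  moreover have "sat C M (Shift C M c2 (nI D)) n \<longleftrightarrow> sat C M c2 (n \<cdot> nI D)"
    using sat_Shift[of c2 "nI D" n] over doms DM E' by simp
  ultimately have sat: "sat C M (snd (composite C M (r2, c2) (r1, c1) D)) m21 \<longleftrightarrow>
      sat C M c1 m1 \<and> sat C M c2 (n \<cdot> nI D)"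
    by (simp add: composite_def)
  have "m21 \<in> matches C M (fst (composite C M (r2, c2) (r1, c1) D)) X0 \<longleftrightarrow>
      n \<cdot> nI D \<in> matches C M r2 (result C d)"
    using extends_dpo_step_iff[OF D lin d E] matches_iff_dpo_step[OF DM(11)]
      matches_iff_dpo_step[OF lin(2)] by blast
  moreover have "m1 \<in> matches C M r1 X0"
    using d matches_iff_dpo_step[OF lin(1)] unfolding dpo_step_def by blast
  ultimately show ?thesis using sat by (auto simp: adm_matches_def)
qed

text \<open>The match \<open>m21\<close> itself witnesses that the composite condition is not
  equivalent to false.\<close>

lemma comp_matchI:
  assumes D: "comp_diagram C M r2 r1 \<mu> D"
    and m: "m21 \<in> adm_matches C M (composite C M (r2, c2) (r1, c1) D) X0" "Dom C m21 = Cod C (pI D)"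
  shows "\<mu> \<in> comp_matches C M (r2, c2) (r1, c1)"
proof -
  have "m21 \<in> M" "sat C M (snd (composite C M (r2, c2) (r1, c1) D)) m21"
    using m(1) by (auto simp: adm_matches_def matches_def)
  then have "\<not> cond_equiv C M (Cod C (pI D)) (snd (composite C M (r2, c2) (r1, c1) D)) CFalse"
    using m(2) unfolding cond_equiv_def by auto
  then show ?thesis using D unfolding comp_matches_def by auto
qed

lemma comp_adm_matchD:
  assumes D: "comp_diagram C M r2 r1 \<mu> D" and r1: "cond_rule C M (r1, c1)" and r2: "cond_rule C M (r2, c2)"
    and m: "m21 \<in> adm_matches C M (composite C M (r2, c2) (r1, c1) D) X0"
  shows "m21 \<in> M" "Dom C m21 = Cod C (pI D)"
    "m21 \<in> matches C M (fst (composite C M (r2, c2) (r1, c1) D)) X0"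
proof -
  have lin: "linear_rule C M r1" "linear_rule C M r2" using r1 r2 by (auto simp: cond_rule_def)
  note DM = comp_diagram_M[OF D lin]
  have "pushout C (ileg r1) (k1 D) (pI D) (eI D)" "pullback C (x2 D) (x1 D) (g2 D) (g1 D)"
    "pushout C (oleg r1) (k1 D) (nO D) (g1 D)"
    using D by (auto simp: comp_diagram_def pushout_complement_def)
  then have "Cod C (eI D \<cdot> x1 D) = Cod C (pI D)"
    by (auto dest!: pushout_square pullback_square simp: square_iff)
  then show "m21 \<in> M" "Dom C m21 = Cod C (pI D)"
    "m21 \<in> matches C M (fst (composite C M (r2, c2) (r1, c1) D)) X0"
    using m by (auto simp: adm_matches_def matches_def composite_def hom_def)
qed

text \<open>The span and its diagram are arbitrary here, subject to the overlap condition
  \<open>P\<close>, so that the lemma serves both the existence claim and the bijection, where they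
  are chosen beforehand.\<close>

lemma synthesis:
  assumes r1: "cond_rule C M (r1, c1)" and r2: "cond_rule C M (r2, c2)"
    and d: "dpo_diagram C M r1 m1 X0 d" and m1: "m1 \<in> adm_matches C M (r1, c1) X0"
    and m2: "m2 \<in> adm_matches C M (r2, c2) (result C d)"
    and D: "comp_diagram C M r2 r1 \<mu> D" and P: "pullback C (fst \<mu>) (snd \<mu>) m2 (comatch d)"
  obtains m21 where "m21 \<in> adm_matches C M (composite C M (r2, c2) (r1, c1) D) X0"
    "concurrent C d m2 \<mu> D m21" "\<mu> \<in> comp_matches C M (r2, c2) (r1, c1)"
    "dpo_step C M r2 m2 (result C d) =
      dpo_step C M (fst (composite C M (r2, c2) (r1, c1) D)) m21 X0"
proof -
  have lin: "linear_rule C M r1" "linear_rule C M r2" using r1 r2 by (auto simp: cond_rule_def)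
  have "m2 \<in> M" using m2 by (simp add: adm_matches_def matches_def)
  from extends_of_matches[OF D lin d this P] obtain n l m21 where
    E: "extends C M D d n l m21" and m2_eq: "n \<cdot> nI D = m2" by blast
  have adm: "m21 \<in> adm_matches C M (composite C M (r2, c2) (r1, c1) D) X0"
    using extends_adm_iff[OF D r1 r2 d E] m1 m2 m2_eq by simp
  show thesis
  proof (rule that[OF adm])
    show "concurrent C d m2 \<mu> D m21" using extends_concurrent[OF E D] P m2_eq by simp
    show "\<mu> \<in> comp_matches C M (r2, c2) (r1, c1)"
      using comp_matchI[OF D adm comp_adm_matchD(2)[OF D r1 r2 adm]] .
    show "dpo_step C M r2 m2 (result C d) =
      dpo_step C M (fst (composite C M (r2, c2) (r1, c1) D)) m21 X0"
      using extends_dpo_step_iff[OF D lin d E] m2_eq by blast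
  qed
qed

text \<open>Any application \<open>d\<close> at \<open>m21 \<cdot> pI D\<close> is allowed,
  including one selected in advance by the bijection.\<close>

lemma analysis:
  assumes r1: "cond_rule C M (r1, c1)" and r2: "cond_rule C M (r2, c2)"
    and D: "comp_diagram C M r2 r1 \<mu> D"
    and m21: "m21 \<in> adm_matches C M (composite C M (r2, c2) (r1, c1) D) X0"
    and d: "dpo_diagram C M r1 (m21 \<cdot> pI D) X0 d"
  obtains m2 where "m21 \<cdot> pI D \<in> adm_matches C M (r1, c1) X0"
    "m2 \<in> adm_matches C M (r2, c2) (result C d)" "concurrent C d m2 \<mu> D m21"
    "dpo_step C M r2 m2 (result C d) =
      dpo_step C M (fst (composite C M (r2, c2) (r1, c1) D)) m21 X0"
proof -
  have lin: "linear_rule C M r1" "linear_rule C M r2" using r1 r2 by (auto simp: cond_rule_def)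
  from extends_of_comp_match[OF D lin comp_adm_matchD(1,2)[OF D r1 r2 m21] d] obtain n l where
    E: "extends C M D d n l m21" and P: "pullback C (fst \<mu>) (snd \<mu>) (n \<cdot> nI D) (comatch d)" by blast
  have "dpo_step C M r2 (n \<cdot> nI D) (result C d) =
      dpo_step C M (fst (composite C M (r2, c2) (r1, c1) D)) m21 X0"
    using extends_dpo_step_iff[OF D lin d E] by blast
  then show thesis
    using that extends_adm_iff[OF D r1 r2 d E] m21 extends_concurrent[OF E D P] by blast
qed

lemma overlap_exists:
  assumes r1: "cond_rule C M (r1, c1)" and r2: "cond_rule C M (r2, c2)"
    and d: "dpo_diagram C M r1 m1 X0 d" and m2: "m2 \<in> adm_matches C M (r2, c2) (result C d)"
  obtains \<mu> D where "comp_diagram C M r2 r1 \<mu> D" "pullback C (fst \<mu>) (snd \<mu>) m2 (comatch d)"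
proof -
  have lin: "linear_rule C M r1" "linear_rule C M r2" using r1 r2 by (auto simp: cond_rule_def)
  have m: "m2 \<in> M" "Cod C m2 = result C d" "m2 \<in> matches C M r2 (result C d)"
    using m2 by (auto simp: adm_matches_def matches_def hom_def)
  obtain u v where P: "pullback C u v m2 (comatch d)"
    using M_pullback_exists[OF m(1) M_Arr[OF comatch_M[OF d lin(1)]] m(2)] by blast
  obtain D where "comp_diagram C M r2 r1 (u, v) D"
    using comp_diagram_exists[OF lin d m(3) P] by blast
  then show thesis using that P by fastforce
qed

lemma comp_match_dpo_diagram:
  assumes r1: "cond_rule C M (r1, c1)" and r2: "cond_rule C M (r2, c2)"
    and D: "comp_diagram C M r2 r1 \<mu> D"
    and m21: "m21 \<in> adm_matches C M (composite C M (r2, c2) (r1, c1) D) X0"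
  obtains d where "dpo_diagram C M r1 (m21 \<cdot> pI D) X0 d"
proof -
  have lin: "linear_rule C M r1" "linear_rule C M r2" using r1 r2 by (auto simp: cond_rule_def)
  show thesis
    using comp_match_first_match[OF D lin comp_adm_matchD(3)[OF D r1 r2 m21]]
      matches_iff_dpo_step[OF lin(1)] that
    unfolding dpo_step_def by blast
qed

text \<open>The relation \<open>R\<close> is total and single-valued on two-step sequences, by
  synthesis and uniqueness of pullbacks, and \<open>F\<close> is its choice function. Injectivity
  holds since \<open>m21\<close> determines both matches; surjectivity is analysis followed by
  uniqueness.\<close>

lemma concurrent_bijection:
  assumes r1: "cond_rule C M (r1, c1)" and r2: "cond_rule C M (r2, c2)"
    and d1: "\<And>m1. m1 \<in> adm_matches C M (r1, c1) X0 \<Longrightarrow> dpo_diagram C M r1 m1 X0 (d1 m1)"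
    and D: "\<And>\<mu>. \<mu> \<in> comp_matches C M (r2, c2) (r1, c1) \<Longrightarrow> comp_diagram C M r2 r1 \<mu> (D \<mu>)"
    and T: "T \<subseteq> comp_matches C M (r2, c2) (r1, c1)"
    and rep: "\<And>\<mu>. \<mu> \<in> comp_matches C M (r2, c2) (r1, c1) \<Longrightarrow> \<exists>!\<tau>. \<tau> \<in> T \<and> span_iso C \<mu> \<tau>"
  shows "\<exists>F. bij_betw F
               (SIGMA m1 : adm_matches C M (r1, c1) X0.
                  adm_matches C M (r2, c2) (result C (d1 m1)))
               (SIGMA \<mu> : T. adm_matches C M (composite C M (r2, c2) (r1, c1) (D \<mu>)) X0) \<and>
             (\<forall>m1 \<in> adm_matches C M (r1, c1) X0.
              \<forall>m2 \<in> adm_matches C M (r2, c2) (result C (d1 m1)).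
              \<forall>\<mu> m21. F (m1, m2) = (\<mu>, m21) \<longrightarrow>
                concurrent C (d1 m1) m2 \<mu> (D \<mu>) m21 \<and>
                (\<forall>X2 Y. dpo_step C M r2 m2 (result C (d1 m1)) X2 \<and>
                   dpo_step C M (fst (composite C M (r2, c2) (r1, c1) (D \<mu>))) m21 X0 Y \<longrightarrow>
                   isomorphic C X2 Y))"
proof -
  have lin: "linear_rule C M r1" "linear_rule C M r2" using r1 r2 by (auto simp: cond_rule_def)
  let ?A = "SIGMA m1 : adm_matches C M (r1, c1) X0. adm_matches C M (r2, c2) (result C (d1 m1))"
  let ?adm = "\<lambda>\<mu>. adm_matches C M (composite C M (r2, c2) (r1, c1) (D \<mu>)) X0"
  let ?B = "SIGMA \<mu> : T. ?adm \<mu>"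
  define R where "R m1 m2 \<mu> m21 \<longleftrightarrow> \<mu> \<in> T \<and> m21 \<in> ?adm \<mu> \<and> concurrent C (d1 m1) m2 \<mu> (D \<mu>) m21"
    for m1 m2 \<mu> m21
  have DT: "comp_diagram C M r2 r1 \<mu> (D \<mu>)" if "\<mu> \<in> T" for \<mu> using that D T by blast
  have ty: "m21 \<in> Arr C" "Dom C m21 = Cod C (pI (D \<mu>))" if "R m1 m2 \<mu> m21" for m1 m2 \<mu> m21
    using comp_adm_matchD[OF DT r1 r2] that M_Arr unfolding R_def by blast+
  have ex: "\<exists>\<mu> m21. R m1 m2 \<mu> m21" if "(m1, m2) \<in> ?A" for m1 m2
  proof -
    have m: "m1 \<in> adm_matches C M (r1, c1) X0" "m2 \<in> adm_matches C M (r2, c2) (result C (d1 m1))"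
      using that by auto
    obtain \<mu> E where E: "comp_diagram C M r2 r1 \<mu> E" and P: "pullback C (fst \<mu>) (snd \<mu>) m2 (comatch (d1 m1))"
      using overlap_exists[OF r1 r2 d1[OF m(1)] m(2)] .
    have "\<mu> \<in> comp_matches C M (r2, c2) (r1, c1)"
      using synthesis[OF r1 r2 d1[OF m(1)] m E P] .
    from rep[OF this] obtain \<tau> where \<tau>: "\<tau> \<in> T" "span_iso C \<mu> \<tau>" by blast
    \<comment> \<open>The overlap found need not be the representative \<open>\<tau>\<close>, so the
      pullback property is carried over to \<open>\<tau>\<close> before synthesis is applied to the
      prescribed diagram \<open>D \<tau>\<close>.\<close>
    have "pushout C (fst \<tau>) (snd \<tau>) (nI (D \<tau>)) (nO (D \<tau>))"
      using DT[OF \<tau>(1)] by (simp add: comp_diagram_def)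
    then have "fst \<tau> \<in> Arr C" "snd \<tau> \<in> Arr C" "Dom C (fst \<tau>) = Dom C (snd \<tau>)"
      by (auto dest!: pushout_square simp: square_iff)
    then have "pullback C (fst \<tau>) (snd \<tau>) m2 (comatch (d1 m1))"
      using pullback_span_iso[OF P] \<tau>(2) by simp
    from synthesis[OF r1 r2 d1[OF m(1)] m DT[OF \<tau>(1)] this] show ?thesis
      using \<tau>(1) unfolding R_def by metis
  qed
  have uniq: "\<mu> = \<mu>' \<and> m21 = m21'"
    if A: "(m1, m2) \<in> ?A" and R: "R m1 m2 \<mu> m21" "R m1 m2 \<mu>' m21'" for m1 m2 \<mu> m21 \<mu>' m21'
  proof -
    have PB: "pullback C (fst \<mu>) (snd \<mu>) m2 (comatch (d1 m1))"
      "pullback C (fst \<mu>') (snd \<mu>') m2 (comatch (d1 m1))"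
      using R by (auto simp: R_def concurrent_def)
    \<comment> \<open>Both spans are pullbacks of the same cospan, so both represent the class of
      \<open>\<mu>\<close> in \<open>T\<close>, which has only one representative.\<close>
    have "span_iso C \<mu> \<mu>" "span_iso C \<mu> \<mu>'"
      using pullback_iso_unique[OF PB(1) PB(1)] pullback_iso_unique[OF PB] by auto
    moreover have "\<mu> \<in> T" "\<mu>' \<in> T" using R by (auto simp: R_def)
    ultimately have eq: "\<mu> = \<mu>'" using rep[of \<mu>] T by blast
    have "dpo_diagram C M r1 m1 X0 (d1 m1)" using A d1 by auto
    from concurrent_match_unique[OF DT[OF \<open>\<mu> \<in> T\<close>] lin(1) this, of m2 m21 m21']
    have "m21 = m21'" using R ty[OF R(1)] ty[OF R(2)] eq unfolding R_def by auto
    with eq show ?thesis by blast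
  qed
  define F where "F p = (SOME q. R (fst p) (snd p) (fst q) (snd q))" for p
  have FR: "R m1 m2 (fst (F (m1, m2))) (snd (F (m1, m2)))" if A: "(m1, m2) \<in> ?A" for m1 m2
  proof -
    have "\<exists>q. R m1 m2 (fst q) (snd q)" using ex[OF A] by auto
    then show ?thesis unfolding F_def fst_conv snd_conv by (rule someI_ex)
  qed
  have inj: "inj_on F ?A"
  proof (rule inj_onI)
    fix p p' assume pA: "p \<in> ?A" "p' \<in> ?A" "F p = F p'"
    obtain m1 m2 m1' m2' where p: "p = (m1, m2)" "p' = (m1', m2')" by (cases p, cases p')
    obtain \<mu> m21 where q: "F p = (\<mu>, m21)" by (cases "F p")
    have R: "R m1 m2 \<mu> m21" "R m1' m2' \<mu> m21"
      using FR[of m1 m2] FR[of m1' m2'] pA p q by auto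
    have dd: "dpo_diagram C M r1 m1 X0 (d1 m1)" "dpo_diagram C M r1 m1' X0 (d1 m1')"
      using pA p d1 by auto
    then have "m21 \<cdot> pI (D \<mu>) = m1" "m21 \<cdot> pI (D \<mu>) = m1'"
      using R by (auto simp: R_def concurrent_def dpo_diagram_def)
    then have eq: "m1 = m1'" by simp
    have "\<mu> \<in> T" using R by (simp add: R_def)
    then have "m2 = m2'"
      using concurrent_second_unique[OF DT lin(1) dd(1)] R eq unfolding R_def by blast
    with eq p show "p = p'" by simp
  qed
  have img: "F ` ?A = ?B"
  proof
    show "F ` ?A \<subseteq> ?B"
    proof
      fix q assume "q \<in> F ` ?A"
      then obtain m1 m2 where "(m1, m2) \<in> ?A" "q = F (m1, m2)" by auto
      then have "fst q \<in> T" "snd q \<in> ?adm (fst q)" using FR[of m1 m2] by (auto simp: R_def)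
      then have "(fst q, snd q) \<in> ?B" by blast
      then show "q \<in> ?B" by simp
    qed
    show "?B \<subseteq> F ` ?A"
    proof
      fix q assume "q \<in> ?B"
      then obtain \<mu> m21 where q: "q = (\<mu>, m21)" "\<mu> \<in> T" "m21 \<in> ?adm \<mu>" by auto
      let ?m1 = "m21 \<cdot> pI (D \<mu>)"
      \<comment> \<open>The function \<open>d1\<close> is specified only on admissible matches. This
        auxiliary application first shows that \<open>?m1\<close> is admissible; analysis is then
        repeated with \<open>d1 ?m1\<close>.\<close>
      obtain d where "dpo_diagram C M r1 ?m1 X0 d"
        using comp_match_dpo_diagram[OF r1 r2 DT[OF q(2)] q(3)] .
      from analysis[OF r1 r2 DT[OF q(2)] q(3) this]
      have m1: "?m1 \<in> adm_matches C M (r1, c1) X0" .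
      obtain m2 where m2: "m2 \<in> adm_matches C M (r2, c2) (result C (d1 ?m1))"
        "concurrent C (d1 ?m1) m2 \<mu> (D \<mu>) m21"
        using analysis[OF r1 r2 DT[OF q(2)] q(3) d1[OF m1]] by metis
      have A: "(?m1, m2) \<in> ?A" using m1 m2 by simp
      have "R ?m1 m2 \<mu> m21" using q m2 by (simp add: R_def)
      then have "F (?m1, m2) = q" using uniq[OF A FR[OF A]] q(1) by (simp add: prod_eq_iff)
      then show "q \<in> F ` ?A" using A by blast
    qed
  qed
  have spec: "concurrent C (d1 m1) m2 \<mu> (D \<mu>) m21 \<and>
      (\<forall>X2 Y. dpo_step C M r2 m2 (result C (d1 m1)) X2 \<and>
         dpo_step C M (fst (composite C M (r2, c2) (r1, c1) (D \<mu>))) m21 X0 Y \<longrightarrow> isomorphic C X2 Y)"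
    if m: "m1 \<in> adm_matches C M (r1, c1) X0" "m2 \<in> adm_matches C M (r2, c2) (result C (d1 m1))"
      and F: "F (m1, m2) = (\<mu>, m21)" for m1 m2 \<mu> m21
  proof -
    have A: "(m1, m2) \<in> ?A" using m by simp
    have R: "R m1 m2 \<mu> m21" using FR[OF A] F by simp
    then have \<mu>: "\<mu> \<in> T" and cc: "concurrent C (d1 m1) m2 \<mu> (D \<mu>) m21" by (auto simp: R_def)
    then have P: "pullback C (fst \<mu>) (snd \<mu>) m2 (comatch (d1 m1))" by (simp add: concurrent_def)
    obtain m21' where s: "m21' \<in> ?adm \<mu>" "concurrent C (d1 m1) m2 \<mu> (D \<mu>) m21'"
      "\<mu> \<in> comp_matches C M (r2, c2) (r1, c1)"
      "dpo_step C M r2 m2 (result C (d1 m1)) =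
        dpo_step C M (fst (composite C M (r2, c2) (r1, c1) (D \<mu>))) m21' X0"
      using synthesis[OF r1 r2 d1[OF m(1)] m DT[OF \<mu>] P] .
    \<comment> \<open>Synthesis may return another match; single-valuedness of \<open>R\<close>
      identifies it with the value of \<open>F\<close>.\<close>
    have "m21' = m21" using uniq[OF A _ R, of \<mu> m21'] \<mu> s(1,2) by (simp add: R_def)
    show ?thesis
      unfolding s(4)[unfolded \<open>m21' = m21\<close>] using cc dpo_step_isomorphic comp_diagram_M(11)[OF DT[OF \<mu>] lin] by blast
  qed
  show ?thesis using inj img spec by (intro exI[of _ F]) (simp add: bij_betw_def)
qed

end

section \<open>Synthesis, analysis and the bijection for rules with application conditions\<close>

theorem theorem4p15:
  fixes C :: "('o, 'a) cat" and M :: "'a set" and X0 :: 'o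
    and r1 r2 :: "'a rule" and c1 c2 :: "('a, 'i) cond"
  assumes "dpo_setting C M"
    and "X0 \<in> Obj C"
    and "cond_rule C M (r1, c1)"
    and "cond_rule C M (r2, c2)"
  shows
    \<comment> \<open>synthesis\<close>
    "(\<forall>m1 X1 m2 X2.
        m1 \<in> adm_matches C M (r1, c1) X0 \<and> dpo_step C M r1 m1 X0 X1 \<and>
        m2 \<in> adm_matches C M (r2, c2) X1 \<and> dpo_step C M r2 m2 X1 X2 \<longrightarrow>
        (\<exists>\<mu> \<in> comp_matches C M (r2, c2) (r1, c1).
           \<exists>D. comp_diagram C M r2 r1 \<mu> D \<and>
             (\<exists>m21 \<in> adm_matches C M (composite C M (r2, c2) (r1, c1) D) X0.
                \<exists>Y. dpo_step C M (fst (composite C M (r2, c2) (r1, c1) D)) m21 X0 Y \<and>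
                    isomorphic C X2 Y))) \<and>
    \<comment> \<open>analysis\<close>
     (\<forall>\<mu> \<in> comp_matches C M (r2, c2) (r1, c1). \<forall>D m21 X2.
        comp_diagram C M r2 r1 \<mu> D \<and>
        m21 \<in> adm_matches C M (composite C M (r2, c2) (r1, c1) D) X0 \<and>
        dpo_step C M (fst (composite C M (r2, c2) (r1, c1) D)) m21 X0 X2 \<longrightarrow>
        (\<exists>m1 \<in> adm_matches C M (r1, c1) X0. \<exists>X1. dpo_step C M r1 m1 X0 X1 \<and>
           (\<exists>m2 \<in> adm_matches C M (r2, c2) X1.
              \<exists>Y. dpo_step C M r2 m2 X1 Y \<and> isomorphic C Y X2))) \<and>
    \<comment> \<open>bijection, for any choice \<open>d1\<close> of the first rule applications, \<open>D\<close> of the composition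
       diagrams and \<open>T\<close> of representatives of the spans up to isomorphism\<close>
     (\<forall>d1 D T.
        (\<forall>m1 \<in> adm_matches C M (r1, c1) X0. dpo_diagram C M r1 m1 X0 (d1 m1)) \<and>
        (\<forall>\<mu> \<in> comp_matches C M (r2, c2) (r1, c1). comp_diagram C M r2 r1 \<mu> (D \<mu>)) \<and>
        T \<subseteq> comp_matches C M (r2, c2) (r1, c1) \<and>
        (\<forall>\<mu> \<in> comp_matches C M (r2, c2) (r1, c1). \<exists>!\<tau>. \<tau> \<in> T \<and> span_iso C \<mu> \<tau>) \<longrightarrow>
        (\<exists>F. bij_betw F
               (SIGMA m1 : adm_matches C M (r1, c1) X0.
                  adm_matches C M (r2, c2) (result C (d1 m1)))
               (SIGMA \<mu> : T. adm_matches C M (composite C M (r2, c2) (r1, c1) (D \<mu>)) X0) \<and>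
             (\<forall>m1 \<in> adm_matches C M (r1, c1) X0.
              \<forall>m2 \<in> adm_matches C M (r2, c2) (result C (d1 m1)).
              \<forall>\<mu> m21. F (m1, m2) = (\<mu>, m21) \<longrightarrow>
                concurrent C (d1 m1) m2 \<mu> (D \<mu>) m21 \<and>
                (\<forall>X2 Y. dpo_step C M r2 m2 (result C (d1 m1)) X2 \<and>
                   dpo_step C M (fst (composite C M (r2, c2) (r1, c1) (D \<mu>))) m21 X0 Y \<longrightarrow>
                   isomorphic C X2 Y))))"
proof -
  interpret dpo_setting C M by (rule assms(1))
  have lin: "linear_rule C M r1" "linear_rule C M r2" using assms(3,4) by (auto simp: cond_rule_def)
  show ?thesis
  proof (intro conjI allI impI ballI, goal_cases)
    case (1 m1 X1 m2 X2)
    then obtain d :: "'a dpo" where d: "dpo_diagram C M r1 m1 X0 d" "result C d = X1"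
      unfolding dpo_step_def by blast
    from 1 d(2) have m: "m1 \<in> adm_matches C M (r1, c1) X0"
      "m2 \<in> adm_matches C M (r2, c2) (result C d)" by auto
    obtain \<mu> D where D: "comp_diagram C M r2 r1 \<mu> D"
      and P: "pullback C (fst \<mu>) (snd \<mu>) m2 (comatch d)"
      using overlap_exists[OF assms(3,4) d(1) m(2)] .
    obtain m21 where m21: "m21 \<in> adm_matches C M (composite C M (r2, c2) (r1, c1) D) X0"
      "concurrent C d m2 \<mu> D m21" "\<mu> \<in> comp_matches C M (r2, c2) (r1, c1)"
      "dpo_step C M r2 m2 (result C d) =
        dpo_step C M (fst (composite C M (r2, c2) (r1, c1) D)) m21 X0"
      using synthesis[OF assms(3,4) d(1) m D P] .
    have X2: "dpo_step C M r2 m2 X1 X2" using 1 by blast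
    then have "dpo_step C M (fst (composite C M (r2, c2) (r1, c1) D)) m21 X0 X2"
      using m21(4) d(2) by simp
    \<comment> \<open>The composite reaches \<open>X2\<close> itself;
      \<open>isomorphic C X2 X2\<close> comes from comparing the second step with itself.\<close>
    then show ?case
      using m21 D X2 dpo_step_isomorphic[OF _ _ lin(2)] by blast
  next
    case (2 \<mu> D m21 X2)
    then have D: "comp_diagram C M r2 r1 \<mu> D"
      and m21: "m21 \<in> adm_matches C M (composite C M (r2, c2) (r1, c1) D) X0"
      and X2: "dpo_step C M (fst (composite C M (r2, c2) (r1, c1) D)) m21 X0 X2" by auto
    obtain d where d: "dpo_diagram C M r1 (m21 \<cdot>\<^bsub>C\<^esub> pI D) X0 d"
      using comp_match_dpo_diagram[OF assms(3,4) D m21] .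
    obtain m2 where m: "m21 \<cdot>\<^bsub>C\<^esub> pI D \<in> adm_matches C M (r1, c1) X0"
      "m2 \<in> adm_matches C M (r2, c2) (result C d)" "concurrent C d m2 \<mu> D m21"
      "dpo_step C M r2 m2 (result C d) =
        dpo_step C M (fst (composite C M (r2, c2) (r1, c1) D)) m21 X0"
      using analysis[OF assms(3,4) D m21 d] .
    have "dpo_step C M r1 (m21 \<cdot>\<^bsub>C\<^esub> pI D) X0 (result C d)"
      unfolding dpo_step_def using d by blast
    moreover have "dpo_step C M r2 m2 (result C d) X2" using m(4) X2 by simp
    ultimately show ?case using m(1,2) dpo_step_isomorphic[OF _ _ lin(2)] by blast
  next
    case (3 d1 D T)
    then show ?case by (intro concurrent_bijection[OF assms(3,4)]) blast+
  qed
qed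

end
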